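(* There is an absolute constant integer $c>0$ such that the following holds. For all integers $m\ge n\ge 1$ and all distributions $F_B,F_S$ on $\mathbb{R}$ such that $F_B$ first-order stochastically dominates $F_S$, the expected gains from trade of the Seller Trade Reduction (STR) mechanism run on $m+c$ buyers with values i.i.d. from $F_B$ and $n+c$ sellers with values i.i.d. from $F_S$ is at least the expected first-best gains from trade with $m$ buyers with values i.i.d. from $F_B$ and $n$ sellers with values i.i.d. from $F_S$. That is, $\mathrm{STR}(m+c,n+c)\ge \mathrm{OPT}(m,n)$.
   Context: Double auction: there are unit-demand buyers, each with private value drawn i.i.d. from $F_B$, and unit-supply sellers (each holding one identical item), each with private value (cost) drawn i.i.d. from $F_S$; all values are independent. For quantile $q\in(0,1)$ let $b(q)=\inf\{x:\Pr_{b\sim F_B}[b\le x]\ge q\}$ and $s(q)=\inf\{x:\Pr_{s\sim F_S}[s\le x]\ge q\}$; $F_B$ first-order stochastically dominates $F_S$ if $b(q)\ge s(q)$ for all $q\in(0,1)$. Given buyer values sorted $b^{(1)}\ge\dots\ge b^{(m)}$ and seller values sorted $s^{(1)}\le\dots\le s^{(n)}$, let $r=\max\{i\le\min(m,n): b^{(i)}\ge s^{(i)}\}$ ($r=0$ if no such $i$). The first-best allocation trades the $r$ highest buyers with the $r$ lowest sellers, with gains from trade $\sum_{i=1}^r (b^{(i)}-s^{(i)})$; $\mathrm{OPT}(m,n)$ is its expectation. Seller Trade Reduction: set $s^{(n+1)}=\infty$; if $b^{(r)}\ge s^{(r+1)}$, the $r$ highest buyers trade with the $r$ lowest sellers (at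 price $s^{(r+1)}$); otherwise only the $r-1$ highest buyers trade with the $r-1$ lowest sellers (buyers pay $b^{(r)}$, sellers receive $s^{(r)}$). Its gains from trade is the sum of traded buyers' values minus the sum of traded sellers' values; $\mathrm{STR}(m,n)$ denotes its expectation with $m$ buyers and $n$ sellers. *)

theory Defs
  imports "HOL-Probability.Probability"
begin

definition quantile :: "real measure \<Rightarrow> real \<Rightarrow> real" where
  "quantile M q = Inf {x. q \<le> measure M {..x}}"

definition fosd :: "real measure \<Rightarrow> real measure \<Rightarrow> bool" where
  "fosd FB FS \<longleftrightarrow> (\<forall>q. 0 < q \<and> q < 1 \<longrightarrow> quantile FS q \<le> quantile FB q)"

(* Buyer values sorted decreasingly: bs ! (i-1) = b^(i);
   seller values sorted increasingly: ss ! (i-1) = s^(i). *)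
definition sorted_buyers :: "real list \<Rightarrow> real list" where
  "sorted_buyers bv = rev (sort bv)"

definition sorted_sellers :: "real list \<Rightarrow> real list" where
  "sorted_sellers sv = sort sv"

definition trade_size :: "real list \<Rightarrow> real list \<Rightarrow> nat" where
  "trade_size bs ss = Max ({0} \<union> {i. 1 \<le> i \<and> i \<le> min (length bs) (length ss)
                                   \<and> ss ! (i - 1) \<le> bs ! (i - 1)})"

definition gft_opt :: "real list \<Rightarrow> real list \<Rightarrow> real" where
  "gft_opt bv sv =
     (let bs = sorted_buyers bv; ss = sorted_sellers sv; r = trade_size bs ss
      in \<Sum>i<r. bs ! i - ss ! i)"

(* Seller Trade Reduction gains from trade; s^(n+1) = infinity *)
definition gft_str :: "real list \<Rightarrow> real list \<Rightarrow> real" where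
  "gft_str bv sv =
     (let bs = sorted_buyers bv; ss = sorted_sellers sv; r = trade_size bs ss
      in if r = 0 then 0
         else if r < length ss \<and> ss ! r \<le> bs ! (r - 1)
              then (\<Sum>i<r. bs ! i - ss ! i)
              else (\<Sum>i<r - 1. bs ! i - ss ! i))"

definition values_measure :: "nat \<Rightarrow> nat \<Rightarrow> real measure \<Rightarrow> real measure
                               \<Rightarrow> ((nat \<Rightarrow> real) \<times> (nat \<Rightarrow> real)) measure" where
  "values_measure m n FB FS = (PiM {..<m} (\<lambda>_. FB)) \<Otimes>\<^sub>M (PiM {..<n} (\<lambda>_. FS))"

(* Expected gains (gains are nonnegative, so the nonnegative integral is used) *)
definition OPT_exp :: "nat \<Rightarrow> nat \<Rightarrow> real measure \<Rightarrow> real measure \<Rightarrow> ennreal" where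
  "OPT_exp m n FB FS = (\<integral>\<^sup>+ v. ennreal (gft_opt (map (fst v) [0..<m]) (map (snd v) [0..<n]))
                      \<partial>values_measure m n FB FS)"

definition STR_exp :: "nat \<Rightarrow> nat \<Rightarrow> real measure \<Rightarrow> real measure \<Rightarrow> ennreal" where
  "STR_exp m n FB FS = (\<integral>\<^sup>+ v. ennreal (gft_str (map (fst v) [0..<m]) (map (snd v) [0..<n]))
                      \<partial>values_measure m n FB FS)"

end

theory Submission
  imports Defs
begin

text \<open>
  Couple buyers and sellers through i.i.d. uniform quantiles. In the augmented market with \<open>M\<close> buyers
  and \<open>N = n + c\<close> sellers let \<open>p\<close> be the \<open>N\<close>-th highest of all values, \<open>r\<close> the number of trades and
  \<open>V = \<Sum> max 0 (p - s)\<close> the surplus of the sellers at price \<open>p\<close>. By duality, deleting agents costs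
  the first best at least the surplus of the deleted sellers, on average \<open>c V / N\<close> by symmetry, while
  trade reduction costs at most \<open>V / r\<close>. It remains to control the outcomes with few trades.
  Interchanging the quantiles of a buyer without an item and of a seller who keeps the item preserves
  the measure and, by stochastic dominance, adds a trade without decreasing \<open>V\<close>. Counting such
  pairs, \<open>A\<^sub>r = E[V; r trades]\<close> satisfies \<open>(M - r) (N - r) A\<^sub>r \<le> (r + 1)\<^sup>2 A\<^bsub>r+1\<^esub>\<close>, so that
  \<open>A\<^sub>r\<close> grows by a factor of \<open>4\<close> up to \<open>r = N/3\<close>. Hence \<open>\<Sum> A\<^sub>r / r \<le> (c / N) \<Sum> A\<^sub>r\<close> for \<open>c \<ge> 8\<close>.
\<close>

section \<open>Order statistics and gains from trade\<close>

text \<open>A property inherited by smaller elements holds on a prefix of a sorted list, and the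
  length of that prefix is the number of elements with the property. Order statistics thus become
  counts, which serve both the comparison with the price and measurability.\<close>

lemma sorted_nth_iff_filter:
  fixes xs :: "'a::linorder list"
  assumes "sorted xs" "i < length xs" and P: "\<And>x y. x \<le> y \<Longrightarrow> P y \<Longrightarrow> P x"
  shows "P (xs ! i) \<longleftrightarrow> i < length (filter P xs)"
  using assms(1,2)
proof (induction xs arbitrary: i)
  case (Cons x xs)
  show ?case
  proof (cases "P x")
    case True
    then show ?thesis using Cons by (cases i) auto
  next
    case False
    then have no: "\<not> P y" if "y \<in> set (x # xs)" for y
      using Cons.prems P[of x y] that by auto
    then have "filter P (x # xs) = []"
      by (auto simp: filter_empty_conv)
    moreover have "\<not> P ((x # xs) ! i)"
      using no Cons.prems(2) nth_mem by blast
    ultimately show ?thesis by simp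
  qed
qed simp

lemma length_filter_sort: "length (filter P (sort xs)) = length (filter P xs)"
  by (metis mset_filter mset_sort size_mset)

lemma sort_nth_iff_filter:
  fixes xs :: "'a::linorder list"
  assumes "i < length xs" and "\<And>x y. x \<le> y \<Longrightarrow> P y \<Longrightarrow> P x"
  shows "P (sort xs ! i) \<longleftrightarrow> i < length (filter P xs)"
  using sorted_nth_iff_filter[of "sort xs" i P] assms by (simp add: length_filter_sort)

text \<open>The ascending statement, applied to the complement of \<open>P\<close> at the mirrored
  index \<open>length xs - Suc i\<close>.\<close>

lemma rev_sort_nth_iff_filter:
  fixes xs :: "'a::linorder list"
  assumes i: "i < length xs" and P: "\<And>x y. x \<le> y \<Longrightarrow> P x \<Longrightarrow> P y"
  shows "P (rev (sort xs) ! i) \<longleftrightarrow> i < length (filter P xs)"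
proof -
  have "\<not> P (sort xs ! (length xs - Suc i)) \<longleftrightarrow> length xs - Suc i < length (filter (\<lambda>x. \<not> P x) xs)"
    using i P by (intro sort_nth_iff_filter) auto
  moreover have "length (filter (\<lambda>x. \<not> P x) xs) + length (filter P xs) = length xs"
    using sum_length_filter_compl[of P xs] by simp
  ultimately show ?thesis
    using i by (auto simp: rev_nth)
qed

lemma length_filter_map_upt: "length (filter P (map f [0..<n])) = card {i. i < n \<and> P (f i)}"
proof -
  have "length (filter P (map f [0..<n])) = length (filter (P \<circ> f) [0..<n])"
    by (simp add: filter_map)
  also have "\<dots> = card (set (filter (P \<circ> f) [0..<n]))"
    by (rule distinct_card[symmetric]) simp
  also have "set (filter (P \<circ> f) [0..<n]) = {i. i < n \<and> P (f i)}"
    by auto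
  finally show ?thesis .
qed

lemma sorted_sellers_nth_iff:
  assumes "i < n" and "\<And>x y. x \<le> y \<Longrightarrow> P y \<Longrightarrow> P x"
  shows "P (sorted_sellers (map f [0..<n]) ! i) \<longleftrightarrow> i < card {k. k < n \<and> P (f k)}"
  using sort_nth_iff_filter[of i "map f [0..<n]" P] assms
  by (simp only: sorted_sellers_def length_filter_map_upt) simp

lemma sorted_buyers_nth_iff:
  assumes "i < n" and "\<And>x y. x \<le> y \<Longrightarrow> P x \<Longrightarrow> P y"
  shows "P (sorted_buyers (map f [0..<n]) ! i) \<longleftrightarrow> i < card {k. k < n \<and> P (f k)}"
  using rev_sort_nth_iff_filter[of i "map f [0..<n]" P] assms
  by (simp only: sorted_buyers_def length_filter_map_upt) simp

lemma length_sorted_buyers [simp]: "length (sorted_buyers xs) = length xs"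
  and length_sorted_sellers [simp]: "length (sorted_sellers xs) = length xs"
  by (simp_all add: sorted_buyers_def sorted_sellers_def)

lemma sorted_sellers_mono: "i \<le> j \<Longrightarrow> j < length xs \<Longrightarrow> sorted_sellers xs ! i \<le> sorted_sellers xs ! j"
  by (simp add: sorted_sellers_def sorted_nth_mono)

lemma sorted_buyers_mono: "i \<le> j \<Longrightarrow> j < length xs \<Longrightarrow> sorted_buyers xs ! j \<le> sorted_buyers xs ! i"
  by (simp add: sorted_buyers_def sorted_rev_nth_mono)

lemma sum_nth_mset_cong:
  assumes "mset xs = mset ys"
  shows "(\<Sum>i<length xs. g (xs ! i)) = (\<Sum>i<length ys. g (ys ! i))"
proof -
  have *: "(\<Sum>i<length zs. g (zs ! i)) = sum_mset (image_mset g (mset zs))" for zs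
  proof -
    have "sum_list (map g zs) = (\<Sum>i<length zs. g (zs ! i))"
      by (subst sum_list_sum_nth) (simp add: atLeast0LessThan)
    then show ?thesis
      by (metis mset_map sum_mset_sum_list)
  qed
  show ?thesis by (simp only: * assms)
qed

lemma sum_sorted_buyers:
  "(\<Sum>i<n. g (sorted_buyers (map f [0..<n]) ! i)) = (\<Sum>i<n. g (f i))"
  using sum_nth_mset_cong[of "sorted_buyers (map f [0..<n])" "map f [0..<n]" g]
  by (simp add: sorted_buyers_def)

lemma sum_sorted_sellers:
  "(\<Sum>i<n. g (sorted_sellers (map f [0..<n]) ! i)) = (\<Sum>i<n. g (f i))"
  using sum_nth_mset_cong[of "sorted_sellers (map f [0..<n])" "map f [0..<n]" g]
  by (simp add: sorted_sellers_def)

lemma trade_size_finite: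
  "finite {i. 1 \<le> i \<and> i \<le> min (length bs) (length ss) \<and> ss ! (i - 1) \<le> bs ! (i - 1)}"
  by (rule finite_subset[of _ "{..min (length bs) (length ss)}"]) auto

lemma trade_size_mem:
  "trade_size bs ss \<in> {0} \<union> {i. 1 \<le> i \<and> i \<le> min (length bs) (length ss) \<and> ss ! (i - 1) \<le> bs ! (i - 1)}"
  unfolding trade_size_def by (rule Max_in) (use trade_size_finite in auto)

lemma trade_size_le: "trade_size bs ss \<le> min (length bs) (length ss)"
  using trade_size_mem[of bs ss] by auto

lemma trade_size_eqI:
  assumes "r \<le> min (length bs) (length ss)"
    and "r = 0 \<or> ss ! (r - 1) \<le> bs ! (r - 1)"
    and "\<And>i. r \<le> i \<Longrightarrow> i < min (length bs) (length ss) \<Longrightarrow> bs ! i < ss ! i"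
  shows "trade_size bs ss = r"
  unfolding trade_size_def
proof (rule Max_eqI)
  fix y assume y: "y \<in> {0} \<union> {i. 1 \<le> i \<and> i \<le> min (length bs) (length ss) \<and> ss ! (i - 1) \<le> bs ! (i - 1)}"
  show "y \<le> r"
  proof (rule ccontr)
    assume "\<not> y \<le> r"
    then have "bs ! (y - 1) < ss ! (y - 1)" using y by (intro assms(3)) auto
    then show False using y \<open>\<not> y \<le> r\<close> by auto
  qed
qed (use trade_size_finite assms in auto)

text \<open>For \<open>r > 0\<close> the last trade is profitable by the choice of \<open>r\<close>,
  and sortedness makes every earlier pair at least as profitable. Hence \<open>ennreal\<close> does
  not truncate the gains.\<close>

lemma gft_opt_nonneg: "0 \<le> gft_opt bv sv"
proof -
  define bs where "bs = sorted_buyers bv"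
  define ss where "ss = sorted_sellers sv"
  define r where "r = trade_size bs ss"
  note r = trade_size_mem[of bs ss, folded r_def]
  have "ss ! i \<le> bs ! i" if i: "i < r" for i
  proof -
    have "ss ! i \<le> ss ! (r - 1)" "bs ! (r - 1) \<le> bs ! i"
      using i r sorted_sellers_mono[of i "r - 1" sv] sorted_buyers_mono[of i "r - 1" bv]
      by (auto simp: bs_def ss_def)
    then show ?thesis using r i by auto
  qed
  then have "0 \<le> (\<Sum>i<r. bs ! i - ss ! i)" by (intro sum_nonneg) auto
  then show ?thesis by (simp add: gft_opt_def Let_def bs_def ss_def r_def)
qed

text \<open>Weak linear programming duality, with the price \<open>p\<close> as dual solution.\<close>

lemma gft_opt_le:
  fixes p :: real
  shows "gft_opt (map f [0..<m]) (map g [0..<n]) \<le> (\<Sum>i<m. max 0 (f i - p)) + (\<Sum>j<n. max 0 (p - g j))"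
proof -
  define bs where "bs = sorted_buyers (map f [0..<m])"
  define ss where "ss = sorted_sellers (map g [0..<n])"
  define r where "r = trade_size bs ss"
  have r: "r \<le> m" "r \<le> n"
    using trade_size_le[of bs ss] by (auto simp: r_def bs_def ss_def)
  have "gft_opt (map f [0..<m]) (map g [0..<n]) = (\<Sum>i<r. bs ! i - ss ! i)"
    by (simp add: gft_opt_def Let_def bs_def ss_def r_def)
  also have "\<dots> \<le> (\<Sum>i<r. max 0 (bs ! i - p) + max 0 (p - ss ! i))"
    by (rule sum_mono) auto
  also have "\<dots> = (\<Sum>i<r. max 0 (bs ! i - p)) + (\<Sum>i<r. max 0 (p - ss ! i))"
    by (rule sum.distrib)
  also have "\<dots> \<le> (\<Sum>i<m. max 0 (bs ! i - p)) + (\<Sum>i<n. max 0 (p - ss ! i))"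
    using r by (intro add_mono sum_mono2) auto
  finally show ?thesis
    using sum_sorted_buyers[of "\<lambda>x. max 0 (x - p)" f m] sum_sorted_sellers[of "\<lambda>x. max 0 (p - x)" g n]
    by (simp add: bs_def ss_def)
qed

section \<open>The market-clearing price\<close>

text \<open>Breaking ties by index makes this a strict total order on the agents, so that exactly
  \<open>N\<close> agents win even when values coincide.\<close>

definition outranks :: "(nat \<Rightarrow> real) \<Rightarrow> nat \<Rightarrow> nat \<Rightarrow> bool" where
  "outranks v a b \<longleftrightarrow> v b < v a \<or> v b = v a \<and> a < b"

text \<open>Agents are numbered with the \<open>M\<close> buyers first, so that ties are resolved in favour of buyers,
  as in the definition of the trade size.\<close>

definition winners :: "nat \<Rightarrow> nat \<Rightarrow> (nat \<Rightarrow> real) \<Rightarrow> nat set" where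
  "winners M N v = {a. a < M + N \<and> card {a'. a' < M + N \<and> outranks v a' a} < N}"

text \<open>The lowest winning value is a competitive price: winning buyers purchase, winning
  sellers keep their item. For \<open>N = 0\<close> the \<open>Min\<close> is over the empty set,
  whence the assumption \<open>N > 0\<close> below.\<close>

definition price :: "nat \<Rightarrow> nat \<Rightarrow> (nat \<Rightarrow> real) \<Rightarrow> real" where
  "price M N v = Min (v ` winners M N v)"

definition trades :: "nat \<Rightarrow> nat \<Rightarrow> (nat \<Rightarrow> real) \<Rightarrow> nat" where
  "trades M N v = card (winners M N v \<inter> {..<M})"

definition seller_surplus :: "nat \<Rightarrow> nat \<Rightarrow> (nat \<Rightarrow> real) \<Rightarrow> real" where
  "seller_surplus M N v = (\<Sum>j\<in>{M..<M+N}. max 0 (price M N v - v j))"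

text \<open>An element of \<open>T\<close> can only be outranked by the other \<open>N - 1\<close>
  elements of \<open>T\<close>, whereas an outsider is outranked by all \<open>N\<close> of
  them.\<close>

lemma winners_eqI:
  assumes T: "T \<subseteq> {..<M+N}" "card T = N"
    and out: "\<And>a b. a \<in> T \<Longrightarrow> b < M + N \<Longrightarrow> b \<notin> T \<Longrightarrow> outranks v a b"
  shows "winners M N v = T"
proof -
  have fin: "finite T" using T(1) finite_subset by blast
  have "card {a'. a' < M + N \<and> outranks v a' a} < N" if a: "a \<in> T" for a
  proof -
    have "{a'. a' < M + N \<and> outranks v a' a} \<subseteq> T - {a}"
      using out[OF a] by (fastforce simp: outranks_def)
    then have "card {a'. a' < M + N \<and> outranks v a' a} \<le> card (T - {a})"
      by (intro card_mono) (use fin in auto)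
    also have "\<dots> < N" using a fin T(2) by (metis card_Diff1_less)
    finally show ?thesis .
  qed
  moreover have "\<not> card {a'. a' < M + N \<and> outranks v a' b} < N" if b: "b < M + N" "b \<notin> T" for b
  proof -
    have "T \<subseteq> {a'. a' < M + N \<and> outranks v a' b}" using out b T by auto
    then have "card T \<le> card {a'. a' < M + N \<and> outranks v a' b}"
      by (intro card_mono) auto
    then show ?thesis using T(2) by simp
  qed
  ultimately show ?thesis using T(1) by (auto simp: winners_def)
qed

text \<open>Greedy choice: each round adds the best remaining agent, so every chosen agent outranks
  every remaining one.\<close>

lemma top_set_exists:
  assumes "n \<le> k"
  shows "\<exists>T\<subseteq>{..<k}. card T = n \<and> (\<forall>a\<in>T. \<forall>b<k. b \<notin> T \<longrightarrow> outranks v a b)"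
  using assms
proof (induction n)
  case 0
  show ?case by (intro exI[of _ "{}"]) auto
next
  case (Suc n)
  then obtain T where T: "T \<subseteq> {..<k}" "card T = n" "\<forall>a\<in>T. \<forall>b<k. b \<notin> T \<longrightarrow> outranks v a b"
    by auto
  have fin: "finite T" using T(1) finite_subset by blast
  define R where "R = {..<k} - T"
  have "R \<noteq> {}"
  proof
    assume "R = {}"
    then have "T = {..<k}" using T(1) by (auto simp: R_def)
    then show False using T(2) Suc.prems by simp
  qed
  moreover have finR: "finite R" by (simp add: R_def)
  ultimately have "Max (v ` R) \<in> v ` R" by (intro Max_in) auto
  \<comment> \<open>Among the remaining agents of maximal value, the one with the least index
    outranks the others.\<close>
  define a where "a = (LEAST a. a \<in> R \<and> v a = Max (v ` R))"
  have "\<exists>a. a \<in> R \<and> v a = Max (v ` R)" using \<open>Max (v ` R) \<in> v ` R\<close> by auto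
  then have a: "a \<in> R" "v a = Max (v ` R)"
    unfolding a_def by (metis (mono_tags, lifting) LeastI)+
  have "outranks v a b" if b: "b \<in> R" "b \<noteq> a" for b
  proof -
    have le: "v b \<le> v a" using b finR a by simp
    have "a \<le> b" if "v b = v a"
      using Least_le[of "\<lambda>a. a \<in> R \<and> v a = Max (v ` R)" b] b(1) that a(2) unfolding a_def by metis
    then show ?thesis using le b by (fastforce simp: outranks_def)
  qed
  then show ?case
    using a(1) T fin by (intro exI[of _ "insert a T"]) (auto simp: R_def)
qed

lemma winners_props:
  shows winners_subset: "winners M N v \<subseteq> {..<M+N}"
    and card_winners: "card (winners M N v) = N"
    and winners_outrank: "a \<in> winners M N v \<Longrightarrow> b < M + N \<Longrightarrow> b \<notin> winners M N v \<Longrightarrow> outranks v a b"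
proof -
  obtain T where T: "T \<subseteq> {..<M+N}" "card T = N" "\<forall>a\<in>T. \<forall>b<M+N. b \<notin> T \<longrightarrow> outranks v a b"
    using top_set_exists[of N "M + N" v] by auto
  have "winners M N v = T" using T by (intro winners_eqI) auto
  then show "winners M N v \<subseteq> {..<M+N}" "card (winners M N v) = N"
    "a \<in> winners M N v \<Longrightarrow> b < M + N \<Longrightarrow> b \<notin> winners M N v \<Longrightarrow> outranks v a b"
    using T by auto
qed

lemma finite_winners [simp]: "finite (winners M N v)"
  by (rule finite_subset[OF winners_subset finite_lessThan])

lemma card_winning_sellers: "card (winners M N v \<inter> {M..<M+N}) = N - trades M N v"
proof -
  have "winners M N v = (winners M N v \<inter> {..<M}) \<union> (winners M N v \<inter> {M..<M+N})"
    using winners_subset[of M N v] by auto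
  then have "card (winners M N v) = trades M N v + card (winners M N v \<inter> {M..<M+N})"
    unfolding trades_def by (subst card_Un_disjoint[symmetric]) auto
  then show ?thesis by (simp add: card_winners)
qed

lemma trades_le: "trades M N v \<le> N" "trades M N v \<le> M"
proof -
  show "trades M N v \<le> N"
    unfolding trades_def using card_mono[of "winners M N v" "winners M N v \<inter> {..<M}"]
    by (simp add: card_winners)
  show "trades M N v \<le> M"
    unfolding trades_def using card_mono[of "{..<M}" "winners M N v \<inter> {..<M}"] by simp
qed

lemma card_losing_buyers: "card ({..<M} - winners M N v) = M - trades M N v"
  by (simp add: trades_def card_Diff_subset_Int Int_commute)

text \<open>As many agents win as there are sellers, so every winning buyer displaces one
  seller.\<close>

lemma card_losing_sellers: "card ({M..<M+N} - winners M N v) = trades M N v"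
  using card_winning_sellers[of M N v] trades_le(1)[of M N v]
  by (simp add: card_Diff_subset_Int Int_commute)

lemma price_le: "a \<in> winners M N v \<Longrightarrow> price M N v \<le> v a"
  by (simp add: price_def)

lemma price_attained: "N > 0 \<Longrightarrow> \<exists>a\<in>winners M N v. price M N v = v a"
proof -
  assume "N > 0"
  then have "winners M N v \<noteq> {}" using card_winners[of M N v] by auto
  then have "Min (v ` winners M N v) \<in> v ` winners M N v" by (intro Min_in) auto
  then show ?thesis by (auto simp: price_def)
qed

lemma price_ge: "N > 0 \<Longrightarrow> b < M + N \<Longrightarrow> b \<notin> winners M N v \<Longrightarrow> v b \<le> price M N v"
  using price_attained[of N M v] winners_outrank[of _ M N v b] by (force simp: outranks_def)

text \<open>The price is the \<open>N\<close>-th highest value, so it is determined by counts. These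
  ignore tie-breaking and the order of the agents, hence serve permutation invariance and
  measurability.\<close>

lemma le_price_iff:
  assumes "N > 0"
  shows "x \<le> price M N v \<longleftrightarrow> N \<le> card {a. a < M + N \<and> x \<le> v a}"
proof
  assume "x \<le> price M N v"
  then have "winners M N v \<subseteq> {a. a < M + N \<and> x \<le> v a}"
    using winners_subset[of M N v] price_le[of _ M N v] by force
  then have "card (winners M N v) \<le> card {a. a < M + N \<and> x \<le> v a}"
    by (intro card_mono) auto
  then show "N \<le> card {a. a < M + N \<and> x \<le> v a}" by (simp add: card_winners)
next
  assume *: "N \<le> card {a. a < M + N \<and> x \<le> v a}"
  obtain a where a: "a \<in> winners M N v" "price M N v = v a"
    using price_attained[OF assms] by blast
  show "x \<le> price M N v"
  proof (rule ccontr)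
    assume "\<not> x \<le> price M N v"
    then have "{b. b < M + N \<and> x \<le> v b} \<subseteq> {b. b < M + N \<and> outranks v b a}"
      using a by (auto simp: outranks_def)
    then have "card {b. b < M + N \<and> x \<le> v b} \<le> card {b. b < M + N \<and> outranks v b a}"
      by (intro card_mono) auto
    then show False using * a(1) by (simp add: winners_def)
  qed
qed

text \<open>The \<open>R\<close> winning buyers and the winning sellers lie at or above the price,
  the losing buyers and the \<open>R\<close> losing sellers at or below it; hence the first
  \<open>R\<close> order statistics of each side trade. \<open>price_cases\<close> reflects that the
  price is set by the lowest winner, either a buyer or a seller who keeps the item.\<close>

lemma gft_structure:
  fixes v :: "nat \<Rightarrow> real" and M N :: nat
  assumes N: "N > 0"
  defines "bs \<equiv> sorted_buyers (map v [0..<M])"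
    and "ss \<equiv> sorted_sellers (map (\<lambda>j. v (M + j)) [0..<N])"
    and "p \<equiv> price M N v" and "R \<equiv> trades M N v"
  shows buyers_above: "i < R \<Longrightarrow> p \<le> bs ! i"
    and buyers_below: "R \<le> i \<Longrightarrow> i < M \<Longrightarrow> bs ! i \<le> p"
    and sellers_below: "i < R \<Longrightarrow> ss ! i \<le> p"
    and sellers_above: "R \<le> i \<Longrightarrow> i < N \<Longrightarrow> p \<le> ss ! i"
    and trade_size_trades: "trade_size bs ss = R"
    and price_cases: "bs ! (R - 1) \<le> p \<or> R < N \<and> ss ! R \<le> p"
proof -
  let ?W = "winners M N v"
  have RN: "R \<le> N" "R \<le> M" using trades_le by (auto simp: R_def)
  have shift: "card {k. k < N \<and> P (M + k)} = card {j \<in> {M..<M+N}. P j}" for P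
  proof -
    have "{j \<in> {M..<M+N}. P j} = (+) M ` {k. k < N \<and> P (M + k)}"
      by (auto simp: image_iff) (metis add_diff_inverse_nat add_less_cancel_left not_less)
    then show ?thesis by (simp add: card_image)
  qed
  have bsP: "P (bs ! i) \<longleftrightarrow> i < card {k. k < M \<and> P (v k)}"
    if "i < M" "\<And>x y. x \<le> y \<Longrightarrow> P x \<Longrightarrow> P y" for P i
    unfolding bs_def by (rule sorted_buyers_nth_iff) (use that in auto)
  have ssP: "P (ss ! i) \<longleftrightarrow> i < card {j \<in> {M..<M+N}. P (v j)}"
    if "i < N" "\<And>x y. x \<le> y \<Longrightarrow> P y \<Longrightarrow> P x" for P i
    unfolding ss_def shift[symmetric, of "\<lambda>j. P (v j)"]
    by (rule sorted_sellers_nth_iff) (use that in auto)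
  show ba: "p \<le> bs ! i" if i: "i < R" for i
  proof -
    have "?W \<inter> {..<M} \<subseteq> {k. k < M \<and> p \<le> v k}" using price_le by (auto simp: p_def)
    from card_mono[OF _ this] have "R \<le> card {k. k < M \<and> p \<le> v k}"
      by (simp add: R_def trades_def)
    then show ?thesis using bsP[of i "\<lambda>x. p \<le> x"] i RN by auto
  qed
  show sb: "ss ! i \<le> p" if i: "i < R" for i
  proof -
    have "{M..<M+N} - ?W \<subseteq> {j\<in>{M..<M+N}. v j \<le> p}" using price_ge[OF N] by (auto simp: p_def)
    from card_mono[OF _ this] have "R \<le> card {j\<in>{M..<M+N}. v j \<le> p}"
      by (simp add: R_def card_losing_sellers)
    then show ?thesis using ssP[of i "\<lambda>x. x \<le> p"] i RN by auto
  qed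
  \<comment> \<open>Only \<open>R\<close> buyers win, so an upward closed property of the order
    statistic at an index \<open>i >= R\<close> holds for more than \<open>R\<close> buyers, one of
    whom loses.\<close>
  have losing_buyer: "\<exists>k<M. k \<notin> ?W \<and> P (v k)"
    if "R \<le> i" "i < M" "P (bs ! i)" "\<And>x y. x \<le> y \<Longrightarrow> P x \<Longrightarrow> P y" for P i
  proof (rule ccontr)
    assume "\<not> ?thesis"
    then have "{k. k < M \<and> P (v k)} \<subseteq> ?W \<inter> {..<M}" by auto
    from card_mono[OF _ this] have "card {k. k < M \<and> P (v k)} \<le> R"
      by (simp add: R_def trades_def)
    then show False using bsP[of i P] that by auto
  qed
  have winning_seller: "\<exists>j\<in>{M..<M+N}. j \<in> ?W \<and> P (v j)"
    if "R \<le> i" "i < N" "P (ss ! i)" "\<And>x y. x \<le> y \<Longrightarrow> P y \<Longrightarrow> P x" for P i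
  proof (rule ccontr)
    assume "\<not> ?thesis"
    then have "{j\<in>{M..<M+N}. P (v j)} \<subseteq> {M..<M+N} - ?W" by auto
    from card_mono[OF _ this] have "card {j\<in>{M..<M+N}. P (v j)} \<le> R"
      by (simp add: R_def card_losing_sellers)
    then show False using ssP[of i P] that by auto
  qed
  show bb: "bs ! i \<le> p" if i: "R \<le> i" "i < M" for i
  proof (rule ccontr)
    assume "\<not> ?thesis"
    then obtain k where "k < M" "k \<notin> ?W" "p < v k"
      using losing_buyer[OF i, of "\<lambda>x. p < x"] by auto
    then show False using price_ge[OF N, of k M v] by (simp add: p_def)
  qed
  show sa: "p \<le> ss ! i" if i: "R \<le> i" "i < N" for i
  proof (rule ccontr)
    assume "\<not> ?thesis"
    then obtain j where "j \<in> ?W" "v j < p"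
      using winning_seller[OF i, of "\<lambda>x. x < p"] by auto
    then show False using price_le[of j M N v] by (simp add: p_def)
  qed
  show "trade_size bs ss = R"
  proof (rule trade_size_eqI)
    show "R \<le> min (length bs) (length ss)" using RN by (simp add: bs_def ss_def)
    show "R = 0 \<or> ss ! (R - 1) \<le> bs ! (R - 1)"
      using ba[of "R - 1"] sb[of "R - 1"] by (cases "R = 0") auto
    fix i assume i: "R \<le> i" "i < min (length bs) (length ss)"
    then have i': "i < M" "i < N" by (auto simp: bs_def ss_def)
    \<comment> \<open>Equality would put both values at the price and yield a losing buyer worth at
      least \<open>p\<close> and a winning seller worth at most \<open>p\<close>, against
      tie-breaking in favour of buyers.\<close>
    have "bs ! i \<noteq> ss ! i"
    proof
      assume eq: "bs ! i = ss ! i"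
      then have "bs ! i = p" "ss ! i = p" using bb[OF i(1) i'(1)] sa[OF i(1) i'(2)] by auto
      then obtain k j where "k < M" "k \<notin> ?W" "p \<le> v k" "j \<in> {M..<M+N}" "j \<in> ?W" "v j \<le> p"
        using losing_buyer[OF i(1) i'(1), of "\<lambda>x. p \<le> x"] winning_seller[OF i(1) i'(2), of "\<lambda>x. x \<le> p"]
        by auto
      then show False using winners_outrank[of j M N v k] by (auto simp: outranks_def)
    qed
    then show "bs ! i < ss ! i" using bb[OF i(1) i'(1)] sa[OF i(1) i'(2)] by auto
  qed
  \<comment> \<open>A winner \<open>a\<close> has value \<open>p\<close>. If \<open>a\<close> is a
    buyer, at most \<open>R - 1\<close> buyers exceed \<open>p\<close>; if \<open>a\<close> is a
    seller, it joins the \<open>R\<close> losing sellers at or below \<open>p\<close>.\<close>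
  obtain a where a: "a \<in> ?W" "p = v a" using price_attained[OF N] by (auto simp: p_def)
  show "bs ! (R - 1) \<le> p \<or> R < N \<and> ss ! R \<le> p"
  proof (cases "a < M")
    case True
    have "{k. k < M \<and> p < v k} \<subseteq> ?W \<inter> {..<M} - {a}"
    proof
      fix k assume k: "k \<in> {k. k < M \<and> p < v k}"
      then have "k \<in> ?W" using price_ge[OF N, of k M v] by (auto simp: p_def)
      then show "k \<in> ?W \<inter> {..<M} - {a}" using k a by auto
    qed
    from card_mono[OF _ this] have "card {k. k < M \<and> p < v k} \<le> card (?W \<inter> {..<M} - {a})" by simp
    also have "\<dots> = R - 1" using a True by (simp add: R_def trades_def card_Diff_singleton)
    finally have le: "card {k. k < M \<and> p < v k} \<le> R - 1" .
    have "R > 0" using a True by (auto simp: R_def trades_def card_gt_0_iff)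
    then have "\<not> p < bs ! (R - 1)"
      using bsP[of "R - 1" "\<lambda>x. p < x"] le RN by auto
    then show ?thesis by auto
  next
    case False
    then have aS: "a \<in> ?W \<inter> {M..<M+N}" using a winners_subset[of M N v] by auto
    then have "0 < card (?W \<inter> {M..<M+N})" by (auto simp: card_gt_0_iff)
    then have lt: "R < N" by (simp add: card_winning_sellers R_def)
    have "insert a ({M..<M+N} - ?W) \<subseteq> {j\<in>{M..<M+N}. v j \<le> p}"
      using price_ge[OF N, of _ M v] aS a(2) unfolding p_def by auto
    from card_mono[OF _ this] have "Suc R \<le> card {j\<in>{M..<M+N}. v j \<le> p}"
      using aS by (simp add: R_def card_losing_sellers)
    then show ?thesis using lt ssP[of R "\<lambda>x. x \<le> p"] by auto
  qed
qed

section \<open>Surpluses at the clearing price and the loss from trade reduction\<close>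

lemma shift_seller_sum:
  "(\<Sum>j\<in>{M..<M+N}. f j) = (\<Sum>j<N. f (M + j :: nat))"
  using sum.shift_bounds_nat_ivl[of f 0 M N] by (simp add: atLeast0LessThan add.commute)

lemma seller_surplus_eq:
  assumes "N > 0"
  shows "seller_surplus M N v =
    (\<Sum>i<trades M N v. price M N v - sorted_sellers (map (\<lambda>j. v (M + j)) [0..<N]) ! i)"
proof -
  let ?p = "price M N v" and ?ss = "sorted_sellers (map (\<lambda>j. v (M + j)) [0..<N])" and ?R = "trades M N v"
  have "seller_surplus M N v = (\<Sum>j<N. max 0 (?p - v (M + j)))"
    by (simp add: seller_surplus_def shift_seller_sum)
  also have "\<dots> = (\<Sum>j<N. max 0 (?p - ?ss ! j))"
    by (rule sum_sorted_sellers[of "\<lambda>x. max 0 (?p - x)", symmetric])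
  also have "\<dots> = (\<Sum>j<?R. max 0 (?p - ?ss ! j))"
    using trades_le(1)[of M N v] sellers_above[OF assms, where M = M and v = v]
    by (intro sum.mono_neutral_right) auto
  also have "\<dots> = (\<Sum>j<?R. ?p - ?ss ! j)"
    using sellers_below[OF assms, where M = M and v = v] by (intro sum.cong) (auto simp: max_def)
  finally show ?thesis .
qed

lemma buyer_surplus_eq:
  assumes "N > 0"
  shows "(\<Sum>i<M. max 0 (v i - price M N v)) =
    (\<Sum>i<trades M N v. sorted_buyers (map v [0..<M]) ! i - price M N v)"
proof -
  let ?p = "price M N v" and ?bs = "sorted_buyers (map v [0..<M])" and ?R = "trades M N v"
  have "(\<Sum>i<M. max 0 (v i - ?p)) = (\<Sum>j<M. max 0 (?bs ! j - ?p))"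
    by (rule sum_sorted_buyers[of "\<lambda>x. max 0 (x - ?p)", symmetric])
  also have "\<dots> = (\<Sum>j<?R. max 0 (?bs ! j - ?p))"
    using trades_le(2)[of M N v] buyers_below[OF assms, where M = M and v = v]
    by (intro sum.mono_neutral_right) auto
  also have "\<dots> = (\<Sum>j<?R. ?bs ! j - ?p)"
    using buyers_above[OF assms, where M = M and v = v] by (intro sum.cong) (auto simp: max_def)
  finally show ?thesis .
qed

lemma seller_surplus_nonneg: "0 \<le> seller_surplus M N v"
  unfolding seller_surplus_def by (intro sum_nonneg) auto

text \<open>The surpluses of both sides at the price add up to the first best. A reduction drops the
  last of \<open>R\<close> trades, which is worth at most the smallest of the \<open>R\<close> terms
  of \<open>V\<close>, hence at most their average. The bound by \<open>2 * str\<close> will give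
  finiteness of expectations.\<close>

lemma gft_str_lower:
  fixes v :: "nat \<Rightarrow> real" and M N :: nat
  assumes N: "N > 0"
  defines "str \<equiv> gft_str (map v [0..<M]) (map (\<lambda>j. v (M + j)) [0..<N])"
    and "R \<equiv> trades M N v" and "V \<equiv> seller_surplus M N v"
  shows gft_str_nonneg: "0 \<le> str"
    and gft_str_ge_half: "2 \<le> R \<Longrightarrow> V \<le> 2 * str"
    and gft_str_ge_surplus: "(\<Sum>i<M. max 0 (v i - price M N v)) + V \<le> str + V / real R"
proof -
  define bs where "bs = sorted_buyers (map v [0..<M])"
  define ss where "ss = sorted_sellers (map (\<lambda>j. v (M + j)) [0..<N])"
  define p where "p = price M N v"
  note defs = bs_def ss_def p_def R_def
  have ts: "trade_size bs ss = R" unfolding defs by (rule trade_size_trades[OF N])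
  have ba: "p \<le> bs ! i" if "i < R" for i
    using that unfolding defs by (intro buyers_above[OF N])
  have sb: "ss ! i \<le> p" if "i < R" for i
    using that unfolding defs by (intro sellers_below[OF N])
  have RN: "R \<le> N" "R \<le> M" using trades_le by (auto simp: R_def)
  have V: "V = (\<Sum>i<R. p - ss ! i)" unfolding V_def defs by (rule seller_surplus_eq[OF N])
  have B: "(\<Sum>i<M. max 0 (v i - p)) = (\<Sum>i<R. bs ! i - p)"
    unfolding defs by (rule buyer_surplus_eq[OF N])
  have full: "(\<Sum>i<M. max 0 (v i - p)) + V = (\<Sum>i<R. bs ! i - ss ! i)"
    unfolding B V sum.distrib[symmetric] by simp
  have str: "str = (if R = 0 then 0 else if R < N \<and> ss ! R \<le> bs ! (R - 1) then (\<Sum>i<R. bs ! i - ss ! i)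
                    else (\<Sum>i<R - 1. bs ! i - ss ! i))"
    unfolding str_def gft_str_def Let_def bs_def[symmetric] ss_def[symmetric] ts
    by (simp add: ss_def)
  have term_ge: "0 \<le> bs ! i - ss ! i" "p - ss ! i \<le> bs ! i - ss ! i" if "i < R" for i
    using ba[OF that] sb[OF that] by auto
  have split: "(\<Sum>i<R. f i) = (\<Sum>i<R - 1. f i) + f (R - 1)" if "R > 0" for f :: "nat \<Rightarrow> real"
    using that by (cases R) auto
  have str_ge: "(\<Sum>i<R - 1. bs ! i - ss ! i) \<le> str"
    using split[of "\<lambda>i. bs ! i - ss ! i"] term_ge(1)[of "R - 1"] by (auto simp: str)
  moreover have "0 \<le> (\<Sum>i<R - 1. bs ! i - ss ! i)"
    by (intro sum_nonneg term_ge) auto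
  ultimately show "0 \<le> str" by simp
  have smono: "ss ! i \<le> ss ! j" if "i \<le> j" "j < R" for i j
    unfolding ss_def by (rule sorted_sellers_mono) (use that RN in auto)
  show "V \<le> 2 * str" if R2: "2 \<le> R"
  proof -
    \<comment> \<open>The dropped term of \<open>V\<close> is at most the first one, which remains
      because \<open>R >= 2\<close>.\<close>
    have "p - ss ! (R - 1) \<le> p - ss ! 0" using smono[of 0 "R - 1"] R2 by auto
    also have "\<dots> = (\<Sum>i<1. p - ss ! i)" by simp
    also have "\<dots> \<le> (\<Sum>i<R-1. p - ss ! i)" using R2 sb by (intro sum_mono2) auto
    finally have "V \<le> 2 * (\<Sum>i<R-1. p - ss ! i)" using split[of "\<lambda>i. p - ss ! i"] R2 by (simp add: V)
    also have "(\<Sum>i<R-1. p - ss ! i) \<le> (\<Sum>i<R-1. bs ! i - ss ! i)"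
      by (intro sum_mono term_ge) auto
    finally show ?thesis using str_ge by simp
  qed
  have V0: "0 \<le> V" by (simp add: V_def seller_surplus_nonneg)
  show "(\<Sum>i<M. max 0 (v i - price M N v)) + V \<le> str + V / real R"
  proof (cases "R = 0 \<or> R < N \<and> ss ! R \<le> bs ! (R - 1)")
    case True
    \<comment> \<open>No trade is dropped here; for \<open>R = 0\<close> the quotient
      \<open>V / real R\<close> is \<open>0\<close> by the convention on division by zero.\<close>
    then have "str = (\<Sum>i<R. bs ! i - ss ! i)" by (auto simp: str)
    then show ?thesis using full V0 by (simp add: p_def)
  next
    case False
    then have Rpos: "R > 0" and str': "str = (\<Sum>i<R - 1. bs ! i - ss ! i)" by (auto simp: str)
    \<comment> \<open>If \<open>R < N\<close> and \<open>ss ! R <= p\<close>, then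
      \<open>p <= bs ! (R - 1)\<close> would pass the test for full trade. So the dropped buyer is
      worth at most \<open>p\<close>.\<close>
    have "bs ! (R - 1) \<le> p \<or> R < N \<and> ss ! R \<le> p" unfolding defs by (rule price_cases[OF N])
    then have bp: "bs ! (R - 1) \<le> p" using False ba[of "R - 1"] by auto
    have "real R * (p - ss ! (R - 1)) = (\<Sum>i<R. p - ss ! (R - 1))" by simp
    also have "\<dots> \<le> V" unfolding V using smono by (intro sum_mono) auto
    finally have "p - ss ! (R - 1) \<le> V / real R" using Rpos by (simp add: field_simps)
    then have "bs ! (R - 1) - ss ! (R - 1) \<le> V / real R" using bp by simp
    then show ?thesis
      using split[of "\<lambda>i. bs ! i - ss ! i"] Rpos full str' by (simp add: p_def)
  qed
qed

section \<open>Exchanging a losing buyer with a winning seller\<close>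

text \<open>The bounds on \<open>w i\<close> and \<open>w j\<close> are what an exchange of
  quantiles yields under dominance. Buyer \<open>i\<close> takes the place of seller
  \<open>j\<close> among the winners; the price cannot fall, as the new winner is worth at least
  \<open>v j\<close>; and seller \<open>j\<close> contributed nothing to the surplus before.\<close>

lemma winners_exchange:
  fixes v w :: "nat \<Rightarrow> real"
  assumes N: "N > 0"
    and i: "i < M" "i \<notin> winners M N v" and j: "j \<in> {M..<M+N}" "j \<in> winners M N v"
    and wi: "v j \<le> w i" and wj: "w j \<le> v i" and eq: "\<And>a. a \<noteq> i \<Longrightarrow> a \<noteq> j \<Longrightarrow> w a = v a"
  shows winners_exchange_eq: "winners M N w = insert i (winners M N v - {j})"
    and trades_exchange: "trades M N w = Suc (trades M N v)"
    and seller_surplus_exchange: "seller_surplus M N v \<le> seller_surplus M N w"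
proof -
  let ?T = "insert i (winners M N v - {j})"
  have ij: "i < j" "i \<noteq> j" using i j by auto
  have sub: "winners M N v \<subseteq> {..<M+N}" by (rule winners_subset)
  show W: "winners M N w = ?T"
  proof (rule winners_eqI)
    show "?T \<subseteq> {..<M+N}" using sub i by auto
    show "card ?T = N" using i j N card_winners[of M N v] by (simp add: card_insert_if)
    fix a b assume a: "a \<in> ?T" and b: "b < M + N" "b \<notin> ?T"
    have ba: "b = j \<or> b \<noteq> i \<and> b \<noteq> j \<and> b \<notin> winners M N v" using b by auto
    have out: "outranks v c d" if "c \<in> winners M N v" "d < M + N" "d \<notin> winners M N v" for c d
      using winners_outrank that by blast
    show "outranks w a b"
    proof (cases "a = i")
      case True
      show ?thesis
      proof (cases "b = j")
        case True
        \<comment> \<open>Buyer \<open>i\<close> loses to \<open>j\<close> despite the smaller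
          index, so \<open>v i < v j\<close> strictly, and
          \<open>w j <= v i < v j <= w i\<close>.\<close>
        then show ?thesis using \<open>a = i\<close> out[of j i] i j wi wj ij by (auto simp: outranks_def)
      next
        case False
        then have "outranks v j b" "w b = v b" using out[of j b] ba b j eq by auto
        \<comment> \<open>A losing buyer has a smaller index than \<open>j\<close> and so lies
          strictly below \<open>v j\<close>; against a losing seller the smaller index of
          \<open>i\<close> settles ties.\<close>
        then show ?thesis using True wi i j by (cases "b < M") (auto simp: outranks_def)
      qed
    next
      case False
      then have aW: "a \<in> winners M N v" "a \<noteq> j" and wa: "w a = v a" using a eq by auto
      show ?thesis
      proof (cases "b = j")
        case True
        have "outranks v a i" using out[of a i] aW i by auto
        then show ?thesis using True wj wa ij i by (auto simp: outranks_def)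
      next
        case False
        then show ?thesis using out[of a b] aW ba b eq wa by (auto simp: outranks_def)
      qed
    qed
  qed
  have "winners M N w \<inter> {..<M} = insert i (winners M N v \<inter> {..<M})"
    unfolding W using i(1) j(1) by auto
  then show "trades M N w = Suc (trades M N v)" using i by (simp add: trades_def)
  have p: "price M N v \<le> price M N w"
  proof -
    obtain a where a: "a \<in> ?T" "price M N w = w a" using price_attained[OF N] W by metis
    show ?thesis
    proof (cases "a = i")
      case True
      then show ?thesis using a wi price_le[OF j(2)] by simp
    next
      case False
      then show ?thesis using a eq price_le[of a M N v] by auto
    qed
  qed
  show "seller_surplus M N v \<le> seller_surplus M N w"
    unfolding seller_surplus_def
  proof (rule sum_mono)
    fix k assume k: "k \<in> {M..<M+N}"
    show "max 0 (price M N v - v k) \<le> max 0 (price M N w - w k)"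
    proof (cases "k = j")
      case True
      then show ?thesis using price_le[OF j(2)] by simp
    next
      case False
      then show ?thesis using eq[of k] p k i by auto
    qed
  qed
qed

text \<open>The bijection carries over the counts that determine the price; tie-breaking, which
  depends on the numbering, never enters.\<close>

lemma price_permute:
  assumes N: "N > 0" and \<pi>: "bij_betw \<pi> {..<M+N} {..<M+N}"
    and eq: "\<And>a. a < M + N \<Longrightarrow> w a = v (\<pi> a)"
  shows "price M N w = price M N v"
proof -
  have "card {a. a < M + N \<and> x \<le> w a} = card {a. a < M + N \<and> x \<le> v a}" for x
  proof (rule bij_betw_same_card[of \<pi>])
    have img: "\<pi> ` {..<M+N} = {..<M+N}" using \<pi> by (rule bij_betw_imp_surj_on)
    show "bij_betw \<pi> {a. a < M + N \<and> x \<le> w a} {a. a < M + N \<and> x \<le> v a}"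
    proof (rule bij_betw_subset[OF \<pi>])
      show "\<pi> ` {a. a < M + N \<and> x \<le> w a} = {a. a < M + N \<and> x \<le> v a}"
      proof (intro subset_antisym subsetI)
        fix b assume "b \<in> \<pi> ` {a. a < M + N \<and> x \<le> w a}"
        then obtain a where "a < M + N" "x \<le> w a" "b = \<pi> a" by auto
        then show "b \<in> {a. a < M + N \<and> x \<le> v a}" using img eq[of a] by auto
      next
        fix b assume b: "b \<in> {a. a < M + N \<and> x \<le> v a}"
        then have "b \<in> \<pi> ` {..<M+N}" unfolding img by simp
        then obtain a where "a < M + N" "b = \<pi> a" by auto
        then show "b \<in> \<pi> ` {a. a < M + N \<and> x \<le> w a}" using b eq[of a] by auto
      qed
    qed auto
  qed
  then have "x \<le> price M N w \<longleftrightarrow> x \<le> price M N v" for x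
    by (simp add: le_price_iff[OF N])
  then show ?thesis by (metis order_antisym order_refl)
qed

text \<open>The induction keeps the deficit accumulated up to \<open>R\<close> below \<open>(2/R - c/N) a\<^sub>R\<close>,
  which is at most zero once \<open>R \<ge> N/4\<close>.\<close>

lemma weighted_sum_le:
  fixes a :: "nat \<Rightarrow> real" and N c :: nat
  assumes a: "\<And>r. 0 \<le> a r" and c: "8 \<le> c" "c \<le> N"
    and grow: "\<And>r. 1 \<le> r \<Longrightarrow> 3 * r + 2 \<le> N \<Longrightarrow> 4 * a r \<le> a (Suc r)"
  shows "(\<Sum>r=1..N. a r / real r) \<le> real c / real N * (\<Sum>r=1..N. a r)"
proof -
  define R where "R = N div 3"
  define d where "d = (\<lambda>r. (1 / real r - c / real N) * a r)"
  have Npos: "real N > 0" using c by simp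
  have partial: "(\<Sum>r=1..k. d r) \<le> (2 / real k - c / real N) * a k" if "1 \<le> k" "3 * k \<le> N" for k
    using that
  proof (induction k rule: dec_induct)
    case base
    then show ?case using a[of 1] by (simp add: d_def mult_right_mono)
  next
    case (step k)
    have "(\<Sum>r=1..Suc k. d r) \<le> (2 / real k - c / real N) * a k + d (Suc k)"
      using step by simp
    also have "(2 / real k - c / real N) * a k \<le> 2 / real k * a k"
      using a[of k] by (intro mult_right_mono) auto
    also have "\<dots> \<le> 2 / real k * (a (Suc k) / 4)"
      using grow[of k] step by (intro mult_left_mono) auto
    also have "\<dots> = 1 / (2 * real k) * a (Suc k)" by simp
    \<comment> \<open>The coefficients compare because \<open>k + 1 <= 2 * k\<close> for
      \<open>k >= 1\<close>.\<close>
    also have "\<dots> \<le> 1 / real (Suc k) * a (Suc k)"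
      using step a[of "Suc k"] by (intro mult_right_mono divide_left_mono) auto
    finally show ?case by (simp add: d_def algebra_simps)
  qed
  \<comment> \<open>From \<open>N >= 8\<close> follow \<open>R >= 2\<close> and
    \<open>N <= 3 * R + 2 <= 4 * R\<close>; with \<open>c >= 8\<close> this makes
    \<open>2 / R - c / N\<close> nonpositive.\<close>
  have R: "1 \<le> R" "3 * R \<le> N" "N \<le> 4 * R" using c by (auto simp: R_def)
  have "real N * 2 \<le> real c * real R"
  proof -
    have "real N * 2 \<le> 8 * real R" using R by simp
    also have "\<dots> \<le> real c * real R" using c by (intro mult_right_mono) auto
    finally show ?thesis .
  qed
  then have "2 / real R - c / real N \<le> 0" using R Npos by (simp add: field_simps)
  then have "(\<Sum>r=1..R. d r) \<le> 0"
    using partial[OF R(1,2)] a[of R] mult_nonpos_nonneg[of "2 / real R - c / real N" "a R"] by simp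
  moreover have "(\<Sum>r=Suc R..N. d r) \<le> 0"
  proof (rule sum_nonpos)
    fix r assume r: "r \<in> {Suc R..N}"
    have "real N \<le> 4 * real r" using R r by simp
    also have "\<dots> \<le> real c * real r" using c by (intro mult_right_mono) auto
    finally have "1 / real r \<le> c / real N" using r Npos by (simp add: field_simps)
    then show "d r \<le> 0" unfolding d_def using a[of r] by (intro mult_nonpos_nonneg) auto
  qed
  moreover have "(\<Sum>r=1..N. d r) = (\<Sum>r=1..R. d r) + (\<Sum>r=Suc R..N. d r)"
    using sum.ub_add_nat[of 1 R d "N - R"] R(1,2) by (simp del: sum.cl_ivl_Suc)
  ultimately have "(\<Sum>r=1..N. d r) \<le> 0" by simp
  moreover have "(\<Sum>r=1..N. d r) = (\<Sum>r=1..N. a r / real r) - real c / real N * (\<Sum>r=1..N. a r)"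
    by (simp add: d_def left_diff_distrib sum_subtractf sum_distrib_left)
  ultimately show ?thesis by simp
qed

section \<open>Measurability\<close>

text \<open>Winners, price, number of trades and order statistics are all described by counts of
  agents, so their measurability reduces to this one, proved by adding one agent at a time.\<close>

lemma measurable_card_pred:
  fixes K :: nat
  assumes "\<And>a. a < K \<Longrightarrow> Measurable.pred Q (P a)"
  shows "(\<lambda>z. card {a. a < K \<and> P a z}) \<in> measurable Q (count_space UNIV)"
  using assms
proof (induction K)
  case (Suc K)
  have eq: "card {a. a < Suc K \<and> P a z} =
      (if P K z then Suc (card {a. a < K \<and> P a z}) else card {a. a < K \<and> P a z})" for z
  proof -
    have "{a. a < Suc K \<and> P a z} =
        (if P K z then insert K {a. a < K \<and> P a z} else {a. a < K \<and> P a z})"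
      by (auto simp: less_Suc_eq)
    then show ?thesis by auto
  qed
  have IH: "(\<lambda>z. card {a. a < K \<and> P a z}) \<in> measurable Q (count_space UNIV)"
    by (rule Suc.IH) (simp add: Suc.prems)
  show ?case unfolding eq
    by (rule measurable_If[OF measurable_compose[OF IH] IH predE[OF Suc.prems]]) auto
qed simp

lemma measurable_card_pred_less:
  fixes K n :: nat
  assumes "\<And>a. a < K \<Longrightarrow> Measurable.pred Q (P a)"
  shows "Measurable.pred Q (\<lambda>z. card {a. a < K \<and> P a z} < n)"
  by (rule measurable_compose[OF measurable_card_pred[OF assms]]) auto

context
  fixes Q :: "'z measure" and M N :: nat and v :: "'z \<Rightarrow> nat \<Rightarrow> real"
  assumes v: "\<And>a. a < M + N \<Longrightarrow> (\<lambda>z. v z a) \<in> borel_measurable Q"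
    and N: "N > 0"
begin

lemma measurable_winners: "Measurable.pred Q (\<lambda>z. a \<in> winners M N (v z))"
proof (cases "a < M + N")
  case True
  have "Measurable.pred Q (\<lambda>z. outranks (v z) a' a)" if "a' < M + N" for a'
  proof -
    note [measurable] = v[OF that] v[OF True]
    show ?thesis unfolding outranks_def by measurable
  qed
  then show ?thesis
    using True by (simp add: winners_def measurable_card_pred_less)
qed (simp add: winners_def)

lemma measurable_price: "(\<lambda>z. price M N (v z)) \<in> borel_measurable Q"
proof -
  have "Measurable.pred Q (\<lambda>z. x \<le> price M N (v z))" for x
  proof -
    have "Measurable.pred Q (\<lambda>z. x \<le> v z a)" if "a < M + N" for a
      using v[OF that] by measurable
    then have "Measurable.pred Q (\<lambda>z. card {a. a < M + N \<and> x \<le> v z a} < N)"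
      by (rule measurable_card_pred_less)
    then have "Measurable.pred Q (\<lambda>z. \<not> card {a. a < M + N \<and> x \<le> v z a} < N)"
      by measurable
    then show ?thesis unfolding le_price_iff[OF N] not_less .
  qed
  then show ?thesis by (simp add: borel_measurable_iff_ge pred_def)
qed

lemma measurable_trades: "(\<lambda>z. trades M N (v z)) \<in> measurable Q (count_space UNIV)"
proof -
  have "trades M N (v z) = card {a. a < M \<and> a \<in> winners M N (v z)}" for z
    unfolding trades_def by (rule arg_cong[of _ _ card]) auto
  then show ?thesis by (simp add: measurable_card_pred measurable_winners)
qed

lemma measurable_seller_surplus: "(\<lambda>z. seller_surplus M N (v z)) \<in> borel_measurable Q"
  unfolding seller_surplus_def 
  by (intro borel_measurable_sum borel_measurable_max borel_measurable_diff measurable_price v) auto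

lemma measurable_sorted_buyers_nth:
  assumes "i < M"
  shows "(\<lambda>z. sorted_buyers (map (v z) [0..<M]) ! i) \<in> borel_measurable Q"
proof -
  have "Measurable.pred Q (\<lambda>z. x \<le> sorted_buyers (map (v z) [0..<M]) ! i)" for x
  proof -
    have "Measurable.pred Q (\<lambda>z. x \<le> v z a)" if "a < M" for a
    proof -
      have [measurable]: "(\<lambda>z. v z a) \<in> borel_measurable Q" using that by (intro v) simp
      show ?thesis by measurable
    qed
    then have "(\<lambda>z. card {k. k < M \<and> x \<le> v z k}) \<in> measurable Q (count_space UNIV)"
      by (rule measurable_card_pred)
    then have *: "Measurable.pred Q (\<lambda>z. i < card {k. k < M \<and> x \<le> v z k})" by measurable
    have "x \<le> sorted_buyers (map (v z) [0..<M]) ! i \<longleftrightarrow> i < card {k. k < M \<and> x \<le> v z k}" for z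
      by (rule sorted_buyers_nth_iff) (use assms in auto)
    then show ?thesis using * by presburger
  qed
  then show ?thesis by (simp add: borel_measurable_iff_ge pred_def)
qed

lemma measurable_sorted_sellers_nth:
  assumes "i < N"
  shows "(\<lambda>z. sorted_sellers (map (\<lambda>j. v z (M + j)) [0..<N]) ! i) \<in> borel_measurable Q"
proof -
  have "Measurable.pred Q (\<lambda>z. sorted_sellers (map (\<lambda>j. v z (M + j)) [0..<N]) ! i \<le> x)" for x
  proof -
    have "Measurable.pred Q (\<lambda>z. v z (M + a) \<le> x)" if "a < N" for a
    proof -
      have [measurable]: "(\<lambda>z. v z (M + a)) \<in> borel_measurable Q" using that by (intro v) simp
      show ?thesis by measurable
    qed
    then have "(\<lambda>z. card {k. k < N \<and> v z (M + k) \<le> x}) \<in> measurable Q (count_space UNIV)"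
      by (rule measurable_card_pred)
    then have *: "Measurable.pred Q (\<lambda>z. i < card {k. k < N \<and> v z (M + k) \<le> x})" by measurable
    have "sorted_sellers (map (\<lambda>j. v z (M + j)) [0..<N]) ! i \<le> x
        \<longleftrightarrow> i < card {k. k < N \<and> v z (M + k) \<le> x}" for z
      by (rule sorted_sellers_nth_iff) (use assms in auto)
    then show ?thesis using * by presburger
  qed
  then show ?thesis by (simp add: borel_measurable_iff_le pred_def)
qed

text \<open>The number of trades takes finitely many values, and for each of them the gains are a
  fixed sum of order statistics.\<close>

lemma measurable_gft_opt:
  "(\<lambda>z. gft_opt (map (v z) [0..<M]) (map (\<lambda>j. v z (M + j)) [0..<N])) \<in> borel_measurable Q"
proof -
  let ?bs = "\<lambda>z. sorted_buyers (map (v z) [0..<M])"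
  let ?ss = "\<lambda>z. sorted_sellers (map (\<lambda>j. v z (M + j)) [0..<N])"
  have "(\<lambda>z. \<Sum>i<trades M N (v z). ?bs z ! i - ?ss z ! i) \<in> borel_measurable Q"
  proof (rule measurable_compose_countable'[where I = "{..min M N}" and g = "\<lambda>z. trades M N (v z)"
        and f = "\<lambda>R z. \<Sum>i<R. ?bs z ! i - ?ss z ! i"])
    fix R assume "R \<in> {..min M N}"
    then show "(\<lambda>z. \<Sum>i<R. ?bs z ! i - ?ss z ! i) \<in> borel_measurable Q"
      by (intro borel_measurable_sum borel_measurable_diff
          measurable_sorted_buyers_nth measurable_sorted_sellers_nth) auto
  next
    show "(\<lambda>z. trades M N (v z)) \<in> measurable Q (count_space {..min M N})"
      by (rule measurable_count_space_extend[OF subset_UNIV _ measurable_trades])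
        (simp add: trades_le)
  qed auto
  then show ?thesis by (simp add: gft_opt_def Let_def trade_size_trades[OF N])
qed

lemma measurable_gft_str:
  "(\<lambda>z. gft_str (map (v z) [0..<M]) (map (\<lambda>j. v z (M + j)) [0..<N])) \<in> borel_measurable Q"
proof -
  let ?bs = "\<lambda>z. sorted_buyers (map (v z) [0..<M])"
  let ?ss = "\<lambda>z. sorted_sellers (map (\<lambda>j. v z (M + j)) [0..<N])"
  define F where "F = (\<lambda>R z. if R = 0 then 0 else if R < N \<and> ?ss z ! R \<le> ?bs z ! (R - 1)
      then (\<Sum>i<R. ?bs z ! i - ?ss z ! i) else (\<Sum>i<R - 1. ?bs z ! i - ?ss z ! i))"
  have "(\<lambda>z. F (trades M N (v z)) z) \<in> borel_measurable Q"
  proof (rule measurable_compose_countable'[where I = "{..min M N}" and g = "\<lambda>z. trades M N (v z)"])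
    fix R assume R: "R \<in> {..min M N}"
    have S: "(\<lambda>z. \<Sum>i<k. ?bs z ! i - ?ss z ! i) \<in> borel_measurable Q" if "k \<le> R" for k
      using that R by (intro borel_measurable_sum borel_measurable_diff
          measurable_sorted_buyers_nth measurable_sorted_sellers_nth) auto
    have [measurable]: "(\<lambda>z. \<Sum>i<R. ?bs z ! i - ?ss z ! i) \<in> borel_measurable Q"
      "(\<lambda>z. \<Sum>i<R - 1. ?bs z ! i - ?ss z ! i) \<in> borel_measurable Q"
      by (rule S; simp)+
    \<comment> \<open>The order statistic at index \<open>R\<close> exists only for
      \<open>R < N\<close>; otherwise the test fails, as if the next seller had infinite
      cost.\<close>
    consider "R = 0" | "R \<noteq> 0" "R < N" | "R \<noteq> 0" "\<not> R < N" by blast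
    then show "F R \<in> borel_measurable Q"
    proof cases
      case 2
      then have [measurable]: "(\<lambda>z. ?bs z ! (R - 1)) \<in> borel_measurable Q"
        "(\<lambda>z. ?ss z ! R) \<in> borel_measurable Q"
        using R by (auto intro!: measurable_sorted_buyers_nth measurable_sorted_sellers_nth)
      have "F R = (\<lambda>z. if ?ss z ! R \<le> ?bs z ! (R - 1) then (\<Sum>i<R. ?bs z ! i - ?ss z ! i)
          else (\<Sum>i<R - 1. ?bs z ! i - ?ss z ! i))"
        using 2 by (simp add: F_def)
      then show ?thesis by (simp only:) measurable
    qed (simp_all add: F_def S)
  next
    show "(\<lambda>z. trades M N (v z)) \<in> measurable Q (count_space {..min M N})"
      by (rule measurable_count_space_extend[OF subset_UNIV _ measurable_trades])
        (simp add: trades_le)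
  qed auto
  then show ?thesis
    unfolding gft_str_def Let_def trade_size_trades[OF N] F_def
      length_sorted_sellers length_map length_upt diff_zero .
qed

end

section \<open>Quantile coupling\<close>

text \<open>Distinct coordinates of an i.i.d. vector are again i.i.d., and applying \<open>h\<close>
  to each coordinate pushes its law forward.\<close>

lemma distr_PiM_reindex_map:
  assumes U: "prob_space U" and h: "h \<in> borel_measurable U"
    and I: "finite I" "inj_on f I" "f \<in> I \<rightarrow> K"
  shows "(\<lambda>\<omega>. \<lambda>n\<in>I. h (\<omega> (f n))) \<in> measurable (PiM K (\<lambda>_. U)) (PiM I (\<lambda>_. distr U borel h))"
    and "distr (PiM K (\<lambda>_. U)) (PiM I (\<lambda>_. distr U borel h)) (\<lambda>\<omega>. \<lambda>n\<in>I. h (\<omega> (f n)))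
      = PiM I (\<lambda>_. distr U borel h)"
proof -
  let ?D = "distr U borel h"
  have D: "prob_space ?D" using U h by (rule prob_space.prob_space_distr)
  have hD: "h \<in> measurable U ?D" using h by simp
  have m1: "(\<lambda>\<omega>. \<lambda>n\<in>I. \<omega> (f n)) \<in> measurable (PiM K (\<lambda>_. U)) (PiM I (\<lambda>_. U))"
    using I(3) by (intro measurable_restrict measurable_component_singleton) auto
  have m2: "compose I h \<in> measurable (PiM I (\<lambda>_. U)) (PiM I (\<lambda>_. ?D))"
    unfolding compose_def
  proof (rule measurable_restrict)
    fix i assume "i \<in> I"
    then have "(\<lambda>x. x i) \<in> measurable (PiM I (\<lambda>_. U)) U" by (rule measurable_component_singleton)
    then show "(\<lambda>x. h (x i)) \<in> measurable (PiM I (\<lambda>_. U)) ?D"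
      by (rule measurable_compose[OF _ hD])
  qed
  have comp: "(\<lambda>\<omega>. \<lambda>n\<in>I. h (\<omega> (f n))) = compose I h \<circ> (\<lambda>\<omega>. \<lambda>n\<in>I. \<omega> (f n))"
    by (auto simp: compose_def fun_eq_iff)
  show "(\<lambda>\<omega>. \<lambda>n\<in>I. h (\<omega> (f n))) \<in> measurable (PiM K (\<lambda>_. U)) (PiM I (\<lambda>_. ?D))"
    unfolding comp using m1 m2 by (rule measurable_comp)
  have "distr U ?D h = ?D" by (rule distr_cong) auto
  then show "distr (PiM K (\<lambda>_. U)) (PiM I (\<lambda>_. ?D)) (\<lambda>\<omega>. \<lambda>n\<in>I. h (\<omega> (f n))) = PiM I (\<lambda>_. ?D)"
    unfolding comp distr_distr[OF m2 m1, symmetric]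
    using distr_PiM_reindex[of K "\<lambda>_. U" f I] distr_PiM_finite_prob_space'[of I "\<lambda>_. U" "\<lambda>_. ?D" h] U D hD I
    by simp
qed

text \<open>Buyers read the types at \<open>i\<close> and sellers those at \<open>M + j\<close>, so
  one i.i.d. vector of length \<open>M + N\<close> carries the augmented market and its submarkets
  together. They can then be compared pointwise.\<close>

lemma nn_integral_values_measure:
  fixes F :: "(nat \<Rightarrow> real) \<times> (nat \<Rightarrow> real) \<Rightarrow> ennreal"
  assumes U: "prob_space U" and b: "b \<in> borel_measurable U" and s: "s \<in> borel_measurable U"
    and le: "m \<le> M" "n \<le> N"
    and F: "F \<in> borel_measurable (values_measure m n (distr U borel b) (distr U borel s))"
  shows "(\<integral>\<^sup>+ x. F x \<partial>values_measure m n (distr U borel b) (distr U borel s)) =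
    (\<integral>\<^sup>+ z. F (\<lambda>i\<in>{..<m}. b (z i), \<lambda>j\<in>{..<n}. s (z (M + j))) \<partial>PiM {..<M+N} (\<lambda>_. U))"
proof -
  let ?B = "{..<M}" and ?S = "{M..<M+N}"
  define PB where "PB = PiM ?B (\<lambda>_. U)"
  define PS where "PS = PiM ?S (\<lambda>_. U)"
  let ?DB = "PiM {..<m} (\<lambda>_. distr U borel b)" and ?DS = "PiM {..<n} (\<lambda>_. distr U borel s)"
  define \<alpha> where "\<alpha> = (\<lambda>\<omega>. \<lambda>i\<in>{..<m}. b (\<omega> i))"
  define \<beta> where "\<beta> = (\<lambda>\<omega>. \<lambda>j\<in>{..<n}. s (\<omega> (M + j)))"
  interpret U: prob_space U by fact
  interpret PU: product_sigma_finite "\<lambda>_. U" ..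
  have \<alpha>: "\<alpha> \<in> measurable PB ?DB" "distr PB ?DB \<alpha> = ?DB"
    unfolding PB_def \<alpha>_def using le by (intro distr_PiM_reindex_map U b; auto)+
  have \<beta>: "\<beta> \<in> measurable PS ?DS" "distr PS ?DS \<beta> = ?DS"
    unfolding PS_def \<beta>_def using le by (intro distr_PiM_reindex_map U s; auto)+
  have "prob_space ?DS"
    by (intro prob_space_PiM U.prob_space_distr s)
  then have sf: "sigma_finite_measure (distr PS ?DS \<beta>)"
    unfolding \<beta> by (rule prob_space_imp_sigma_finite)
  have V: "values_measure m n (distr U borel b) (distr U borel s) =
      distr (PB \<Otimes>\<^sub>M PS) (?DB \<Otimes>\<^sub>M ?DS) (\<lambda>(x, y). (\<alpha> x, \<beta> y))"
    unfolding values_measure_def using pair_measure_distr[OF \<alpha>(1) \<beta>(1) sf] \<alpha>(2) \<beta>(2) by simp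
  have F': "F \<in> borel_measurable (?DB \<Otimes>\<^sub>M ?DS)"
    using F by (simp add: values_measure_def)
  have \<alpha>\<beta>: "(\<lambda>(x, y). (\<alpha> x, \<beta> y)) \<in> measurable (PB \<Otimes>\<^sub>M PS) (?DB \<Otimes>\<^sub>M ?DS)"
    using \<alpha>(1) \<beta>(1) by measurable
  define \<phi> where "\<phi> = (\<lambda>z. (\<lambda>i\<in>{..<m}. b (z i), \<lambda>j\<in>{..<n}. s (z (M + j))))"
  have \<phi>: "\<phi> \<in> measurable (PiM {..<M+N} (\<lambda>_. U)) (?DB \<Otimes>\<^sub>M ?DS)"
    unfolding \<phi>_def using le
    by (intro measurable_Pair distr_PiM_reindex_map(1)[OF U b, where f = "\<lambda>i. i"]
        distr_PiM_reindex_map(1)[OF U s, where f = "\<lambda>j. M + j"]) auto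
  have un: "?B \<union> ?S = {..<M+N}" by auto
  have mg: "distr (PB \<Otimes>\<^sub>M PS) (PiM {..<M+N} (\<lambda>_. U)) (merge ?B ?S) = PiM {..<M+N} (\<lambda>_. U)"
    using PU.distr_merge[of ?B ?S] by (simp add: PB_def PS_def un ivl_disj_int)
  have mm: "merge ?B ?S \<in> measurable (PB \<Otimes>\<^sub>M PS) (PiM {..<M+N} (\<lambda>_. U))"
    using measurable_merge[of ?B ?S "\<lambda>_. U"] by (simp add: PB_def PS_def un)
  have "(\<integral>\<^sup>+ x. F x \<partial>values_measure m n (distr U borel b) (distr U borel s))
      = (\<integral>\<^sup>+ x. F (case x of (x, y) \<Rightarrow> (\<alpha> x, \<beta> y)) \<partial>(PB \<Otimes>\<^sub>M PS))"
    unfolding V using \<alpha>\<beta> F' by (subst nn_integral_distr) auto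
  also have "\<dots> = (\<integral>\<^sup>+ x. F (\<phi> (merge ?B ?S x)) \<partial>(PB \<Otimes>\<^sub>M PS))"
  proof (intro nn_integral_cong arg_cong[of _ _ F])
    fix x :: "(nat \<Rightarrow> 'a) \<times> (nat \<Rightarrow> 'a)"
    show "(case x of (x, y) \<Rightarrow> (\<alpha> x, \<beta> y)) = \<phi> (merge ?B ?S x)"
      using le by (auto simp: \<alpha>_def \<beta>_def \<phi>_def merge_def split: prod.splits)
  qed
  also have "\<dots> = (\<integral>\<^sup>+ z. F (\<phi> z) \<partial>distr (PB \<Otimes>\<^sub>M PS) (PiM {..<M+N} (\<lambda>_. U)) (merge ?B ?S))"
    by (rule nn_integral_distr[symmetric, OF mm])
      (use measurable_compose[OF \<phi> F'] in simp)
  finally show ?thesis unfolding mg \<phi>_def .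
qed

section \<open>The market with i.i.d. types\<close>

lemma sum_if_pair:
  fixes x :: "'c::comm_semiring_1"
  assumes "finite A" "finite B"
  shows "(\<Sum>i\<in>A. \<Sum>j\<in>B. if p i \<and> q j then x else 0)
    = of_nat (card {i\<in>A. p i} * card {j\<in>B. q j}) * x"
proof -
  have "(\<Sum>j\<in>B. if p i \<and> q j then x else 0) = (if p i then of_nat (card {j\<in>B. q j}) * x else 0)" for i
    using assms(2) by (simp add: sum.inter_filter[symmetric])
  then show ?thesis
    using assms(1) by (simp add: sum.inter_filter[symmetric] mult.assoc)
qed

text \<open>A type plays the role of a quantile. One law \<open>U\<close> for both sides makes all
  coordinates exchangeable, even a buyer's with a seller's, and \<open>s_le_b\<close> is the
  pointwise form of dominance.\<close>

locale coupled_market = prob_space U for U :: "'u measure" +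
  fixes b s :: "'u \<Rightarrow> real" and M N :: nat
  assumes measurable_b [measurable]: "b \<in> borel_measurable U"
    and measurable_s [measurable]: "s \<in> borel_measurable U"
    and s_le_b: "q \<in> space U \<Longrightarrow> s q \<le> b q"
    and N_pos: "N > 0"
begin

abbreviation types :: "(nat \<Rightarrow> 'u) measure" where
  "types \<equiv> PiM {..<M+N} (\<lambda>_. U)"

definition val :: "(nat \<Rightarrow> 'u) \<Rightarrow> nat \<Rightarrow> real" where
  "val z a = (if a < M then b (z a) else s (z a))"

text \<open>Its integral is \<open>A\<^sub>r\<close>. Values in \<open>ennreal\<close> allow the
  exchange inequality before finiteness is known.\<close>

definition level :: "nat \<Rightarrow> (nat \<Rightarrow> 'u) \<Rightarrow> ennreal" where
  "level r z = (if trades M N (val z) = r then ennreal (seller_surplus M N (val z)) else 0)"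

definition str :: "(nat \<Rightarrow> 'u) \<Rightarrow> real" where
  "str z = gft_str (map (val z) [0..<M]) (map (\<lambda>j. val z (M + j)) [0..<N])"

lemma measurable_val [measurable]: "a < M + N \<Longrightarrow> (\<lambda>z. val z a) \<in> borel_measurable types"
  unfolding val_def by measurable

lemmas measurable_market [measurable] =
  measurable_winners[OF measurable_val N_pos]
  measurable_price[OF measurable_val N_pos]
  measurable_trades[OF measurable_val N_pos]
  measurable_seller_surplus[OF measurable_val N_pos]

lemma measurable_str [measurable]: "str \<in> borel_measurable types"
  unfolding str_def by (rule measurable_gft_str[OF measurable_val N_pos])

lemma measurable_level [measurable]: "level r \<in> borel_measurable types"
  unfolding level_def by measurable

lemma nn_integral_permute:
  assumes f: "f \<in> borel_measurable types" and \<tau>: "bij_betw \<tau> {..<M+N} {..<M+N}"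
  shows "(\<integral>\<^sup>+ z. f (\<lambda>a\<in>{..<M+N}. z (\<tau> a)) \<partial>types) = (\<integral>\<^sup>+ z. f z \<partial>types)"
proof -
  have \<tau>': "inj_on \<tau> {..<M+N}" "\<tau> \<in> {..<M+N} \<rightarrow> {..<M+N}"
    using \<tau> by (auto simp: bij_betw_def)
  have "(\<lambda>z. \<lambda>a\<in>{..<M+N}. z (\<tau> a)) \<in> measurable types types"
    using \<tau>'(2) by (intro measurable_restrict measurable_component_singleton) auto
  moreover have "distr types types (\<lambda>z. \<lambda>a\<in>{..<M+N}. z (\<tau> a)) = types"
    using distr_PiM_reindex[of "{..<M+N}" "\<lambda>_. U" \<tau> "{..<M+N}"] \<tau>' prob_space_axioms by simp
  ultimately show ?thesis using nn_integral_distr[of _ types types f] f by metis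
qed

lemma bij_betw_transpose:
  fixes i j k :: nat
  assumes "i < k" "j < k"
  shows "bij_betw (Transposition.transpose i j) {..<k} {..<k}"
  using assms by (intro bij_betw_byWitness[where f' = "Transposition.transpose i j"])
    (auto simp: Transposition.transpose_def)

text \<open>Double counting of pairs. An outcome with \<open>r\<close> trades has
  \<open>(M - r) * (N - r)\<close> pairs of a losing buyer and a winning seller. Exchanging their
  types preserves the law and leads to an outcome with \<open>Suc r\<close> trades and no less
  surplus, in which the pair is one of \<open>Suc r * Suc r\<close> pairs of a winning buyer and a
  losing seller.\<close>

lemma level_exchange:
  "of_nat ((M - r) * (N - r)) * (\<integral>\<^sup>+ z. level r z \<partial>types)
    \<le> of_nat (Suc r * Suc r) * (\<integral>\<^sup>+ z. level (Suc r) z \<partial>types)"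
proof -
  let ?W = "\<lambda>z. winners M N (val z)" and ?B = "{..<M}" and ?S = "{M..<M+N}"
  define lo where "lo = (\<lambda>i j z. if i \<notin> ?W z \<and> j \<in> ?W z then level r z else 0)"
  define hi where "hi = (\<lambda>i j z. if i \<in> ?W z \<and> j \<notin> ?W z then level (Suc r) z else 0)"
  have [measurable]: "lo i j \<in> borel_measurable types" "hi i j \<in> borel_measurable types" for i j
    unfolding lo_def hi_def by measurable
  have swap: "(\<integral>\<^sup>+ z. lo i j z \<partial>types) \<le> (\<integral>\<^sup>+ z. hi i j z \<partial>types)" if i: "i < M" and j: "j \<in> ?S" for i j
  proof -
    define \<sigma> where "\<sigma> = (\<lambda>z. \<lambda>a\<in>{..<M+N}. z (Transposition.transpose i j a) :: 'u)"
    have "lo i j z \<le> hi i j (\<sigma> z)" if z: "z \<in> space types" for z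
    proof (cases "i \<notin> ?W z \<and> j \<in> ?W z")
      case True
      have sp: "z a \<in> space U" if "a < M + N" for a
        using z that by (auto simp: space_PiM)
      \<comment> \<open>Dominance enters here, as \<open>s (z j) <= b (z j)\<close> and
        \<open>s (z i) <= b (z i)\<close>.\<close>
      have vi: "val z j \<le> val (\<sigma> z) i" "val (\<sigma> z) j \<le> val z i"
        using i j s_le_b[OF sp[of i]] s_le_b[OF sp[of j]] by (auto simp: val_def \<sigma>_def)
      \<comment> \<open>\<open>winners_exchange\<close> asks for agreement with \<open>val z\<close>
        at every index other than \<open>i\<close> and \<open>j\<close>; \<open>w\<close> arranges
        this also beyond the agents, where the restricted vector has default values.\<close>
      obtain w where w: "\<And>a. a < M + N \<Longrightarrow> w a = val (\<sigma> z) a" "\<And>a. \<not> a < M + N \<Longrightarrow> w a = val z a"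
        by (rule that[of "\<lambda>a. if a < M + N then val (\<sigma> z) a else val z a"]) auto
      have weq: "w a = val z a" if "a \<noteq> i" "a \<noteq> j" for a
        using w that by (cases "a < M + N") (auto simp: val_def \<sigma>_def)
      have W: "winners M N w = ?W (\<sigma> z)"
        unfolding winners_def outranks_def using w(1) by (intro Collect_cong conj_cong) (auto intro!: arg_cong[of _ _ "\<lambda>A. card A < N"])
      have P: "price M N w = price M N (val (\<sigma> z))"
        unfolding price_def W using w(1) winners_subset[of M N "val (\<sigma> z)"]
        by (intro arg_cong[of _ _ Min] image_cong) auto
      have T: "trades M N w = trades M N (val (\<sigma> z))" by (simp add: trades_def W)
      have S: "seller_surplus M N w = seller_surplus M N (val (\<sigma> z))"
        unfolding seller_surplus_def P using w(1) by (intro sum.cong) auto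
      have wi: "val z j \<le> w i" and wj: "w j \<le> val z i"
        using vi w(1) i j by auto
      note ex = N_pos i conjunct1[OF True] j conjunct2[OF True] wi wj weq
      show ?thesis
        using winners_exchange_eq[OF ex] trades_exchange[OF ex] seller_surplus_exchange[OF ex] True i j
        by (auto simp: W T S lo_def hi_def level_def ennreal_leI)
    qed (auto simp: lo_def)
    then have "(\<integral>\<^sup>+ z. lo i j z \<partial>types) \<le> (\<integral>\<^sup>+ z. hi i j (\<sigma> z) \<partial>types)"
      by (rule nn_integral_mono)
    also have "\<dots> = (\<integral>\<^sup>+ z. hi i j z \<partial>types)"
      unfolding \<sigma>_def using i j by (intro nn_integral_permute bij_betw_transpose) auto
    finally show ?thesis .
  qed
  have lo_sum: "(\<Sum>i\<in>?B. \<Sum>j\<in>?S. lo i j z) = of_nat ((M - r) * (N - r)) * level r z" for z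
  proof (cases "trades M N (val z) = r")
    case True
    have "{i\<in>?B. i \<notin> ?W z} = ?B - ?W z" "{j\<in>?S. j \<in> ?W z} = ?W z \<inter> ?S" by auto
    then show ?thesis unfolding lo_def
      by (subst sum_if_pair) (simp_all add: card_losing_buyers card_winning_sellers True)
  qed (simp add: lo_def level_def)
  have hi_sum: "(\<Sum>i\<in>?B. \<Sum>j\<in>?S. hi i j z) = of_nat (Suc r * Suc r) * level (Suc r) z" for z
  proof (cases "trades M N (val z) = Suc r")
    case True
    have "{i\<in>?B. i \<in> ?W z} = ?W z \<inter> ?B" "{j\<in>?S. j \<notin> ?W z} = ?S - ?W z" by auto
    moreover have "card (?W z \<inter> ?B) = Suc r" using True by (simp add: trades_def)
    ultimately show ?thesis unfolding hi_def
      by (subst sum_if_pair) (simp_all only: card_losing_sellers True finite_lessThan finite_atLeastLessThan)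
  qed (simp add: hi_def level_def)
  have "of_nat ((M - r) * (N - r)) * (\<integral>\<^sup>+ z. level r z \<partial>types)
      = (\<integral>\<^sup>+ z. (\<Sum>i\<in>?B. \<Sum>j\<in>?S. lo i j z) \<partial>types)"
    unfolding lo_sum by (rule nn_integral_cmult[symmetric]) measurable
  also have "\<dots> = (\<Sum>i\<in>?B. \<Sum>j\<in>?S. \<integral>\<^sup>+ z. lo i j z \<partial>types)"
    by (simp add: nn_integral_sum)
  also have "\<dots> \<le> (\<Sum>i\<in>?B. \<Sum>j\<in>?S. \<integral>\<^sup>+ z. hi i j z \<partial>types)"
    by (intro sum_mono swap) auto
  also have "\<dots> = (\<integral>\<^sup>+ z. (\<Sum>i\<in>?B. \<Sum>j\<in>?S. hi i j z) \<partial>types)"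
    by (simp add: nn_integral_sum)
  also have "\<dots> = of_nat (Suc r * Suc r) * (\<integral>\<^sup>+ z. level (Suc r) z \<partial>types)"
    unfolding hi_sum by (rule nn_integral_cmult) measurable
  finally show ?thesis .
qed

section \<open>Symmetry between sellers and the cost of deleting agents\<close>

definition surplus :: "nat \<Rightarrow> (nat \<Rightarrow> 'u) \<Rightarrow> real" where
  "surplus j z = max 0 (price M N (val z) - val z j)"

lemma measurable_surplus [measurable]: "j < M + N \<Longrightarrow> surplus j \<in> borel_measurable types"
  unfolding surplus_def by measurable

text \<open>Swapping the types of two sellers swaps their values and preserves both the law and the
  price.\<close>

lemma nn_integral_surplus_sym:
  assumes i: "i \<in> {M..<M+N}" and j: "j \<in> {M..<M+N}"
  shows "(\<integral>\<^sup>+ z. surplus i z \<partial>types) = (\<integral>\<^sup>+ z. surplus j z \<partial>types)"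
proof -
  define \<tau> where "\<tau> = Transposition.transpose i j"
  have bij: "bij_betw \<tau> {..<M+N} {..<M+N}"
    unfolding \<tau>_def using i j by (intro bij_betw_transpose) auto
  have "surplus i (\<lambda>a\<in>{..<M+N}. z (\<tau> a)) = surplus j z" for z
  proof -
    have eq: "val (\<lambda>a\<in>{..<M+N}. z (\<tau> a)) a = val z (\<tau> a)" if "a < M + N" for a
      using that i j by (auto simp: val_def \<tau>_def Transposition.transpose_def)
    then show ?thesis
      unfolding surplus_def using price_permute[OF N_pos bij, of _ "val z"] eq i j
      by (simp add: \<tau>_def)
  qed
  then show ?thesis
    using nn_integral_permute[OF _ bij, of "\<lambda>z. ennreal (surplus i z)"] i by simp
qed

lemma nn_integral_surplus_sum:
  assumes "J \<subseteq> {M..<M+N}"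
  shows "(\<integral>\<^sup>+ z. ennreal (\<Sum>j\<in>J. surplus j z) \<partial>types) = of_nat (card J) * (\<integral>\<^sup>+ z. surplus M z \<partial>types)"
proof -
  have "(\<integral>\<^sup>+ z. ennreal (\<Sum>j\<in>J. surplus j z) \<partial>types) = (\<integral>\<^sup>+ z. (\<Sum>j\<in>J. ennreal (surplus j z)) \<partial>types)"
    by (intro nn_integral_cong sum_ennreal[symmetric]) (simp add: surplus_def)
  also have "\<dots> = (\<Sum>j\<in>J. \<integral>\<^sup>+ z. surplus j z \<partial>types)"
    using assms by (intro nn_integral_sum) auto
  also have "\<dots> = (\<Sum>j\<in>J. \<integral>\<^sup>+ z. surplus M z \<partial>types)"
    using assms N_pos by (intro sum.cong nn_integral_surplus_sym) auto
  finally show ?thesis by simp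
qed

lemma seller_surplus_val: "seller_surplus M N (val z) = (\<Sum>j\<in>{M..<M+N}. surplus j z)"
  by (simp add: seller_surplus_def surplus_def)

text \<open>The price of the augmented market is also a dual solution for the submarket. Its dual
  bound there lacks exactly the surplus of the deleted agents, and the terms of deleted buyers are
  nonnegative.\<close>

lemma submarket_le:
  assumes "m \<le> M" "n \<le> N"
  shows "gft_opt (map (val z) [0..<m]) (map (\<lambda>j. val z (M + j)) [0..<n]) + (\<Sum>j\<in>{M+n..<M+N}. surplus j z)
    \<le> str z + seller_surplus M N (val z) / real (trades M N (val z))"
proof -
  let ?p = "price M N (val z)"
  have "gft_opt (map (val z) [0..<m]) (map (\<lambda>j. val z (M + j)) [0..<n])
      \<le> (\<Sum>i<m. max 0 (val z i - ?p)) + (\<Sum>j<n. max 0 (?p - val z (M + j)))"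
    by (rule gft_opt_le)
  also have "(\<Sum>i<m. max 0 (val z i - ?p)) \<le> (\<Sum>i<M. max 0 (val z i - ?p))"
    using assms by (intro sum_mono2) auto
  also have "(\<Sum>j<n. max 0 (?p - val z (M + j))) = (\<Sum>j\<in>{M..<M+n}. surplus j z)"
    by (simp add: shift_seller_sum surplus_def)
  finally have "gft_opt (map (val z) [0..<m]) (map (\<lambda>j. val z (M + j)) [0..<n])
      + (\<Sum>j\<in>{M+n..<M+N}. surplus j z)
      \<le> (\<Sum>i<M. max 0 (val z i - ?p)) + ((\<Sum>j\<in>{M..<M+n}. surplus j z) + (\<Sum>j\<in>{M+n..<M+N}. surplus j z))"
    by simp
  also have "(\<Sum>j\<in>{M..<M+n}. surplus j z) + (\<Sum>j\<in>{M+n..<M+N}. surplus j z) = seller_surplus M N (val z)"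
    unfolding seller_surplus_val using assms by (intro sum.atLeastLessThan_concat) auto
  also have "(\<Sum>i<M. max 0 (val z i - ?p)) + seller_surplus M N (val z)
      \<le> str z + seller_surplus M N (val z) / real (trades M N (val z))"
    unfolding str_def by (rule gft_str_ge_surplus[OF N_pos])
  finally show ?thesis .
qed

lemma level_sum:
  "(\<Sum>r=1..N. ennreal (c r) * level r z) =
    (if trades M N (val z) = 0 then 0
     else ennreal (c (trades M N (val z))) * ennreal (seller_surplus M N (val z)))"
proof -
  have "(\<Sum>r=1..N. ennreal (c r) * level r z) =
      (\<Sum>r=1..N. if r = trades M N (val z) then ennreal (c r) * ennreal (seller_surplus M N (val z)) else 0)"
    by (intro sum.cong) (auto simp: level_def)
  then show ?thesis using trades_le(1)[of M N "val z"] by auto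
qed

lemma level_le_str: "2 \<le> r \<Longrightarrow> level r z \<le> 2 * ennreal (str z)"
proof (cases "trades M N (val z) = r")
  case True
  assume "2 \<le> r"
  then have "seller_surplus M N (val z) \<le> 2 * str z"
    unfolding str_def using True by (intro gft_str_ge_half[OF N_pos]) simp
  then have "ennreal (seller_surplus M N (val z)) \<le> ennreal (2 * str z)" by (rule ennreal_leI)
  then show ?thesis using True by (simp add: level_def ennreal_mult')
qed (simp add: level_def)

text \<open>With two or more trades the surplus is at most twice the gains. A reduction of a single
  trade may leave nothing, so level \<open>1\<close> is bounded by level \<open>2\<close> through
  the exchange inequality.\<close>

lemma nn_integral_level_finite:
  assumes str: "(\<integral>\<^sup>+ z. str z \<partial>types) < \<top>" and "2 \<le> M" "2 \<le> N" "1 \<le> r"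
  shows "(\<integral>\<^sup>+ z. level r z \<partial>types) < \<top>"
proof -
  have ge2: "(\<integral>\<^sup>+ z. level r z \<partial>types) < \<top>" if "2 \<le> r" for r
  proof -
    have "(\<integral>\<^sup>+ z. level r z \<partial>types) \<le> (\<integral>\<^sup>+ z. 2 * ennreal (str z) \<partial>types)"
      using that by (intro nn_integral_mono level_le_str)
    also have "\<dots> = 2 * (\<integral>\<^sup>+ z. str z \<partial>types)" by (intro nn_integral_cmult) measurable
    also have "\<dots> < \<top>" using str by (simp add: ennreal_mult_less_top)
    finally show ?thesis .
  qed
  show ?thesis
  proof (cases "r = 1")
    case True
    have "(\<integral>\<^sup>+ z. level 1 z \<partial>types) \<le> of_nat ((M - 1) * (N - 1)) * (\<integral>\<^sup>+ z. level 1 z \<partial>types)"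
    proof -
      have "1 \<le> (M - 1) * (N - 1)" using assms(2,3) by (simp add: Suc_le_eq)
      then have "(1::ennreal) \<le> of_nat ((M - 1) * (N - 1))" by (metis of_nat_1 of_nat_mono)
      then show ?thesis using mult_right_mono by fastforce
    qed
    also have "\<dots> \<le> of_nat (Suc 1 * Suc 1) * (\<integral>\<^sup>+ z. level (Suc 1) z \<partial>types)"
      by (rule level_exchange)
    also have "\<dots> < \<top>"
      using ge2[of "Suc 1"] by (simp add: ennreal_mult_less_top of_nat_less_top)
    finally show ?thesis using True by simp
  qed (use ge2[of r] assms(4) in simp)
qed

text \<open>From \<open>3 * r + 2 <= N <= M\<close> both \<open>M - r\<close> and
  \<open>N - r\<close> are at least \<open>2 * Suc r\<close>, which gives the factor
  \<open>4\<close> between the pair counts.\<close>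

lemma level_growth:
  assumes "N \<le> M" "3 * r + 2 \<le> N"
  shows "4 * (\<integral>\<^sup>+ z. level r z \<partial>types) \<le> (\<integral>\<^sup>+ z. level (Suc r) z \<partial>types)"
proof -
  let ?k = "Suc r * Suc r"
  have "4 * ?k = (2 * Suc r) * (2 * Suc r)" by simp
  also have "\<dots> \<le> (M - r) * (N - r)" using assms by (intro mult_le_mono) auto
  finally have "(of_nat (4 * ?k) :: ennreal) \<le> of_nat ((M - r) * (N - r))" by (rule of_nat_mono)
  then have "of_nat (4 * ?k) * (\<integral>\<^sup>+ z. level r z \<partial>types)
      \<le> of_nat ((M - r) * (N - r)) * (\<integral>\<^sup>+ z. level r z \<partial>types)"
    by (rule mult_right_mono) simp
  also have "\<dots> \<le> of_nat ?k * (\<integral>\<^sup>+ z. level (Suc r) z \<partial>types)" by (rule level_exchange)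
  finally have "of_nat ?k * (4 * (\<integral>\<^sup>+ z. level r z \<partial>types)) \<le> of_nat ?k * (\<integral>\<^sup>+ z. level (Suc r) z \<partial>types)"
    by (simp only: of_nat_mult of_nat_numeral mult.assoc mult.left_commute)
  then show ?thesis
    by (subst (asm) ennreal_mult_le_mult_iff) (simp_all del: of_nat_Suc of_nat_mult)
qed

lemma opt_le_str:
  assumes c: "8 \<le> c" and m: "m \<le> M" and n: "N = n + c" "0 < n" and NM: "N \<le> M"
  shows "(\<integral>\<^sup>+ z. gft_opt (map (val z) [0..<m]) (map (\<lambda>j. val z (M + j)) [0..<n]) \<partial>types)
    \<le> (\<integral>\<^sup>+ z. str z \<partial>types)"
proof (cases "(\<integral>\<^sup>+ z. str z \<partial>types) < \<top>")
  case False
  then show ?thesis by (simp add: not_less top_unique)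
next
  case fin: True
  let ?R = "\<lambda>z. trades M N (val z)" and ?V = "\<lambda>z. seller_surplus M N (val z)"
  let ?opt = "\<lambda>z. gft_opt (map (val z) [0..<m]) (map (\<lambda>j. val z (M + j)) [0..<n])"
  let ?rem = "\<lambda>z. \<Sum>j\<in>{M+n..<M+N}. surplus j z"
  have opt [measurable]: "?opt \<in> borel_measurable types"
  proof -
    \<comment> \<open>\<open>measurable_gft_opt\<close> takes one vector with the sellers directly
      after the buyers; \<open>?v\<close> closes the gap between \<open>m\<close> and
      \<open>M\<close>.\<close>
    let ?v = "\<lambda>z a. if a < m then val z a else val z (M + (a - m))"
    have v: "(\<lambda>z. ?v z a) \<in> borel_measurable types" if "a < m + n" for a
      using that m n(1) measurable_val[of a] measurable_val[of "M + (a - m)"]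
      by (cases "a < m") simp_all
    have eq: "map (?v z) [0..<m] = map (val z) [0..<m]" for z by simp
    show ?thesis
      using measurable_gft_opt[where M = m and v = ?v, OF v n(2)] unfolding eq by simp
  qed
  \<comment> \<open>Finite expected gains of trade reduction make these integrals finite for
    \<open>r >= 1\<close>, so \<open>enn2real\<close> loses nothing there.\<close>
  define a where "a = (\<lambda>r. enn2real (\<integral>\<^sup>+ z. level r z \<partial>types))"
  have lev: "(\<integral>\<^sup>+ z. level r z \<partial>types) = ennreal (a r)" if "1 \<le> r" for r
    using nn_integral_level_finite[OF fin _ _ that] c n NM by (simp add: a_def)
  have a0: "0 \<le> a r" for r by (simp add: a_def)
  \<comment> \<open>The sum can start at \<open>1\<close> because the surplus vanishes when there is
    no trade.\<close>
  have Vle: "ennreal (?V z) = (\<Sum>r=1..N. level r z)" for z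
    using level_sum[of "\<lambda>_. 1" z] seller_surplus_eq[OF N_pos, of M "val z"] by auto
  have EV: "(\<integral>\<^sup>+ z. ?V z \<partial>types) = ennreal (\<Sum>r=1..N. a r)"
  proof -
    have "(\<integral>\<^sup>+ z. ?V z \<partial>types) = (\<Sum>r=1..N. \<integral>\<^sup>+ z. level r z \<partial>types)"
      unfolding Vle by (rule nn_integral_sum) measurable
    also have "\<dots> = (\<Sum>r=1..N. ennreal (a r))" by (intro sum.cong lev) auto
    also have "\<dots> = ennreal (\<Sum>r=1..N. a r)" using a0 by (intro sum_ennreal) auto
    finally show ?thesis .
  qed
  \<comment> \<open>By symmetry every seller has expected surplus \<open>?e\<close>: all
    \<open>N\<close> sellers give the expectation of \<open>?V\<close>, and the \<open>c\<close>
    deleted ones the share \<open>c / N\<close> of it.\<close>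
  let ?e = "\<integral>\<^sup>+ z. surplus M z \<partial>types"
  have Ne: "of_nat N * ?e = ennreal (\<Sum>r=1..N. a r)"
    using nn_integral_surplus_sum[OF order_refl] EV by (simp add: seller_surplus_val)
  then have "of_nat N * ?e < \<top>" by simp
  then have "?e < \<top>" using N_pos by (auto simp: ennreal_mult_less_top)
  then obtain e where e: "?e = ennreal e" "0 \<le> e" by (cases ?e) auto
  have "ennreal (real N * e) = ennreal (\<Sum>r=1..N. a r)"
    using Ne e by (simp add: ennreal_mult ennreal_of_nat_eq_real_of_nat)
  then have Ne': "real N * e = (\<Sum>r=1..N. a r)"
    using e a0 by (subst (asm) ennreal_inj) (auto intro: sum_nonneg)
  have Erem: "(\<integral>\<^sup>+ z. ?rem z \<partial>types) = ennreal (real c * e)"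
    using nn_integral_surplus_sum[of "{M+n..<M+N}"] e n
    by (simp add: ennreal_mult ennreal_of_nat_eq_real_of_nat)
  have "(\<Sum>r=1..N. a r / real r) \<le> real c / real N * (\<Sum>r=1..N. a r)"
  proof (rule weighted_sum_le)
    fix r assume r: "1 \<le> r" "3 * r + 2 \<le> N"
    then have "ennreal (4 * a r) \<le> ennreal (a (Suc r))"
      using level_growth[OF NM r(2)] lev[of r] lev[of "Suc r"] a0 by (simp add: ennreal_mult)
    then show "4 * a r \<le> a (Suc r)" using a0 by simp
  qed (use a0 c n in auto)
  also have "\<dots> = real c * e" unfolding Ne'[symmetric] using N_pos by simp
  finally have key: "(\<Sum>r=1..N. a r / real r) \<le> real c * e" .
  have Eloss: "(\<integral>\<^sup>+ z. ennreal (?V z / real (?R z)) \<partial>types) = ennreal (\<Sum>r=1..N. a r / real r)"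
  proof -
    \<comment> \<open>Without trades both sides are \<open>0\<close>, the left one by division by
      zero.\<close>
    have "ennreal (?V z / real (?R z)) = (\<Sum>r=1..N. ennreal (1 / real r) * level r z)" for z
      unfolding level_sum using seller_surplus_nonneg[of M N "val z"]
      by (simp add: ennreal_mult[symmetric])
    then have "(\<integral>\<^sup>+ z. ennreal (?V z / real (?R z)) \<partial>types)
        = (\<Sum>r=1..N. \<integral>\<^sup>+ z. ennreal (1 / real r) * level r z \<partial>types)"
      by (simp only:) (rule nn_integral_sum, measurable)
    also have "\<dots> = (\<Sum>r=1..N. ennreal (a r / real r))"
    proof (rule sum.cong)
      fix r assume "r \<in> {1..N}"
      then have "(\<integral>\<^sup>+ z. ennreal (1 / real r) * level r z \<partial>types) = ennreal (1 / real r) * ennreal (a r)"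
        using lev[of r] by (subst nn_integral_cmult) auto
      then show "(\<integral>\<^sup>+ z. ennreal (1 / real r) * level r z \<partial>types) = ennreal (a r / real r)"
        using a0 by (simp add: ennreal_mult[symmetric])
    qed simp
    also have "\<dots> = ennreal (\<Sum>r=1..N. a r / real r)" using a0 by (intro sum_ennreal) auto
    finally show ?thesis .
  qed
  have rem0: "0 \<le> ?rem z" for z by (intro sum_nonneg) (simp add: surplus_def)
  have str0: "0 \<le> str z" for z unfolding str_def by (rule gft_str_nonneg[OF N_pos])
  have mrem: "?rem \<in> borel_measurable types" by (intro borel_measurable_sum measurable_surplus) auto
  \<comment> \<open>The surplus of the deleted sellers is added on the left rather than subtracted
    on the right. Its integral is finite and bounds the loss from reduction, so it cancels in the
    end.\<close>
  have "(\<integral>\<^sup>+ z. ?opt z \<partial>types) + (\<integral>\<^sup>+ z. ?rem z \<partial>types) = (\<integral>\<^sup>+ z. ennreal (?opt z) + ennreal (?rem z) \<partial>types)"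
    using mrem opt by (intro nn_integral_add[symmetric]) auto
  also have "\<dots> \<le> (\<integral>\<^sup>+ z. ennreal (str z) + ennreal (?V z / real (?R z)) \<partial>types)"
  proof (rule nn_integral_mono)
    fix z
    have "0 \<le> ?V z / real (?R z)" using seller_surplus_nonneg by simp
    moreover have "?opt z + ?rem z \<le> str z + ?V z / real (?R z)"
      using m n by (intro submarket_le) auto
    ultimately show "ennreal (?opt z) + ennreal (?rem z) \<le> ennreal (str z) + ennreal (?V z / real (?R z))"
      using rem0[of z] str0[of z] gft_opt_nonneg by (simp flip: ennreal_plus add: ennreal_leI)
  qed
  also have "\<dots> = (\<integral>\<^sup>+ z. str z \<partial>types) + (\<integral>\<^sup>+ z. ennreal (?V z / real (?R z)) \<partial>types)"
    by (rule nn_integral_add) measurable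
  also have "\<dots> \<le> (\<integral>\<^sup>+ z. str z \<partial>types) + ennreal (real c * e)"
    unfolding Eloss by (intro add_left_mono ennreal_leI key)
  finally show ?thesis
    unfolding Erem by simp
qed

end

section \<open>Transfer to the given distributions\<close>

lemma measurable_gft_values:
  assumes n: "0 < n" and FB: "sets FB = sets borel" and FS: "sets FS = sets borel"
  shows "(\<lambda>x. gft_opt (map (fst x) [0..<m]) (map (snd x) [0..<n])) \<in> borel_measurable (values_measure m n FB FS)"
    and "(\<lambda>x. gft_str (map (fst x) [0..<m]) (map (snd x) [0..<n])) \<in> borel_measurable (values_measure m n FB FS)"
proof -
  let ?v = "\<lambda>x a. if a < m then fst x a else snd x (a - m)"
  have v: "(\<lambda>x. ?v x a) \<in> borel_measurable (values_measure m n FB FS)" if "a < m + n" for a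
  proof (cases "a < m")
    case True
    then have "(\<lambda>f. f a) \<in> measurable (PiM {..<m} (\<lambda>_. FB)) FB"
      by (intro measurable_component_singleton) simp
    then have "(\<lambda>f. f a) \<in> borel_measurable (PiM {..<m} (\<lambda>_. FB))"
      using measurable_cong_sets[OF refl FB] by blast
    then show ?thesis
      using True unfolding values_measure_def by (simp add: measurable_compose[OF measurable_fst])
  next
    case False
    then have "(\<lambda>f. f (a - m)) \<in> measurable (PiM {..<n} (\<lambda>_. FS)) FS"
      using that by (intro measurable_component_singleton) auto
    then have "(\<lambda>f. f (a - m)) \<in> borel_measurable (PiM {..<n} (\<lambda>_. FS))"
      using measurable_cong_sets[OF refl FS] by blast
    then show ?thesis
      using False unfolding values_measure_def by (simp add: measurable_compose[OF measurable_snd])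
  qed
  have eq: "map (?v x) [0..<m] = map (fst x) [0..<m]" for x :: "(nat \<Rightarrow> real) \<times> (nat \<Rightarrow> real)"
    by simp
  show "(\<lambda>x. gft_opt (map (fst x) [0..<m]) (map (snd x) [0..<n])) \<in> borel_measurable (values_measure m n FB FS)"
    and "(\<lambda>x. gft_str (map (fst x) [0..<m]) (map (snd x) [0..<n])) \<in> borel_measurable (values_measure m n FB FS)"
    using measurable_gft_opt[where M = m and v = ?v, OF v n]
      measurable_gft_str[where M = m and v = ?v, OF v n]
    unfolding eq by simp_all
qed

context coupled_market
begin

lemma expectations_coupled:
  assumes "m \<le> M" "0 < n" "n \<le> N"
  shows "OPT_exp m n (distr U borel b) (distr U borel s) =
      (\<integral>\<^sup>+ z. gft_opt (map (val z) [0..<m]) (map (\<lambda>j. val z (M + j)) [0..<n]) \<partial>types)"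
    and "STR_exp M N (distr U borel b) (distr U borel s) = (\<integral>\<^sup>+ z. str z \<partial>types)"
proof -
  have map_b: "map (\<lambda>i\<in>{..<m}. b (z i)) [0..<m] = map (val z) [0..<m]" if "m \<le> M" for z m
    using that by (auto simp: val_def)
  have map_s: "map (\<lambda>j\<in>{..<n}. s (z (M + j))) [0..<n] = map (\<lambda>j. val z (M + j)) [0..<n]" for z n
    by (auto simp: val_def)
  show "OPT_exp m n (distr U borel b) (distr U borel s) =
      (\<integral>\<^sup>+ z. gft_opt (map (val z) [0..<m]) (map (\<lambda>j. val z (M + j)) [0..<n]) \<partial>types)"
    unfolding OPT_exp_def
    by (subst nn_integral_values_measure[OF prob_space_axioms measurable_b measurable_s, of m M n N])
      (use assms measurable_gft_values(1)[of n] in \<open>simp_all add: map_b map_s\<close>)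
  show "STR_exp M N (distr U borel b) (distr U borel s) = (\<integral>\<^sup>+ z. str z \<partial>types)"
    unfolding STR_exp_def
    by (subst nn_integral_values_measure[OF prob_space_axioms measurable_b measurable_s, of M M N N])
      (use N_pos measurable_gft_values(2)[of N] in \<open>simp_all add: map_b map_s str_def\<close>)
qed

end

text \<open>\<open>quantile F\<close> is the pseudo-inverse of the distribution function, as in
  Skorohod's construction; under the uniform law on the open unit interval it has law
  \<open>F\<close>.\<close>

lemma quantile_coupling:
  assumes "prob_space F" "sets F = sets (borel :: real measure)"
  shows "quantile F \<in> borel_measurable (restrict_space lborel {0<..<1})"
    and "distr (restrict_space lborel {0<..<1}) borel (quantile F) = F"
proof -
  interpret cdf_distribution F
    unfolding cdf_distribution_def real_distribution_def real_distribution_axioms_def using assms by auto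
  have q: "quantile F = I" by (simp add: fun_eq_iff quantile_def cdf_def)
  have "sets (restrict_space lborel {0<..<1::real}) = sets (restrict_space borel {0<..<1})"
    by (rule sets_restrict_space_cong) simp
  then show "quantile F \<in> borel_measurable (restrict_space lborel {0<..<1})"
    unfolding q using measurable_CI measurable_cong_sets by blast
  show "distr (restrict_space lborel {0<..<1}) borel (quantile F) = F"
    unfolding q by (rule distr_I_eq_M)
qed

theorem theorem1p1:
  shows "\<exists>c::nat. c > 0 \<and>
    (\<forall>m n FB FS. 1 \<le> n \<longrightarrow> n \<le> m \<longrightarrow>
       prob_space FB \<longrightarrow> sets FB = sets (borel :: real measure) \<longrightarrow>
       prob_space FS \<longrightarrow> sets FS = sets (borel :: real measure) \<longrightarrow>
       fosd FB FS \<longrightarrow>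
       OPT_exp m n FB FS \<le> STR_exp (m + c) (n + c) FB FS)"
proof (intro exI[of _ 8] conjI allI impI)
  fix m n :: nat and FB FS :: "real measure"
  assume n: "1 \<le> n" "n \<le> m" and FB: "prob_space FB" "sets FB = sets (borel :: real measure)"
    and FS: "prob_space FS" "sets FS = sets (borel :: real measure)" and dom: "fosd FB FS"
  \<comment> \<open>Feeding the same uniform quantile to \<open>quantile FB\<close> and
    \<open>quantile FS\<close> turns dominance into a pointwise inequality.\<close>
  let ?U = "restrict_space lborel {0<..<1::real}"
  have "coupled_market ?U (quantile FB) (quantile FS) (n + 8)"
  proof (intro coupled_market.intro coupled_market_axioms.intro)
    show "prob_space ?U"
      by (auto simp: emeasure_restrict_space space_restrict_space intro!: prob_spaceI)
    show "quantile FS q \<le> quantile FB q" if "q \<in> space ?U" for q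
      using dom that by (simp add: fosd_def space_restrict_space)
  qed (use quantile_coupling FB FS in auto)
  then interpret coupled_market ?U "quantile FB" "quantile FS" "m + 8" "n + 8" .
  note expectations_coupled[of m n, unfolded quantile_coupling(2)[OF FB] quantile_coupling(2)[OF FS]]
  \<comment> \<open>The constant \<open>8\<close> comes from \<open>weighted_sum_le\<close>, where
    \<open>N <= 4 * R\<close> and \<open>2 / R <= c / N\<close> are to hold at
    \<open>R = N div 3\<close>.\<close>
  moreover have "(\<integral>\<^sup>+ z. gft_opt (map (val z) [0..<m]) (map (\<lambda>j. val z (m + 8 + j)) [0..<n]) \<partial>types)
      \<le> (\<integral>\<^sup>+ z. str z \<partial>types)"
    by (rule opt_le_str[of 8]) (use n in auto)
  ultimately show "OPT_exp m n FB FS \<le> STR_exp (m + 8) (n + 8) FB FS"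
    using n by simp
qed simp

end
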